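(* As $n\to\infty$, $$n^{-1/2}\bigl(X_n^*-n/4\bigr)\overset{\mathrm d}{\longrightarrow} N(0,1/16),$$ with convergence of all moments. In particular, $$\mathbb E X_n^*=n/4+o(n^{1/2}),\qquad \operatorname{Var}X_n^*=n/16+o(n).$$
   Context: For $n\ge 2$ let $\sigma$ be a uniformly random permutation of $\{1,\dots,n\}$. For $0\le m\le n$ and $1\le k\le n$ let $I_{n,m}(k)=1$ if $\sigma^{-1}(k)\le m$ and $I_{n,m}(k)=0$ otherwise. (Thus one starts with a string of $n$ zeros and changes the zeros to ones one at a time in uniformly random order; $(I_{n,m}(k))_{k=1}^n$ is the string after $m$ changes.) Let $X_{n,m}$ be the number of runs (maximal blocks of consecutive ones) in the string $I_{n,m}(1),\dots,I_{n,m}(n)$, i.e. $$X_{n,m}=I_{n,m}(1)+\sum_{k=1}^{n-1}(1-I_{n,m}(k))I_{n,m}(k+1),$$ and let $X_n^*=\max_{0\le m\le n}X_{n,m}$. $\overset{\mathrm d}{\longrightarrow}$ denotes convergence in distribution, and "convergence of all moments" means that all moments of the left-hand side converge to the corresponding moments of the limit. *)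

theory Defs
  imports "HOL-Probability.Probability"
begin

definition uniform_perm :: "nat \<Rightarrow> (nat \<Rightarrow> nat) pmf" where
  "uniform_perm n = pmf_of_set {\<sigma>. \<sigma> permutes {1..n}}"

definition I_ind :: "(nat \<Rightarrow> nat) \<Rightarrow> nat \<Rightarrow> nat \<Rightarrow> nat" where
  "I_ind \<sigma> m k = (if inv \<sigma> k \<le> m then 1 else 0)"

(* The truncated subtraction in the sum is exact, as I_ind takes values in {0, 1}. *)
definition num_runs :: "nat \<Rightarrow> (nat \<Rightarrow> nat) \<Rightarrow> nat \<Rightarrow> nat" where
  "num_runs n \<sigma> m =
     I_ind \<sigma> m 1 + (\<Sum>k = 1..n - 1. (1 - I_ind \<sigma> m k) * I_ind \<sigma> m (k + 1))"

definition max_runs :: "nat \<Rightarrow> (nat \<Rightarrow> nat) \<Rightarrow> nat" where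
  "max_runs n \<sigma> = Max (num_runs n \<sigma> ` {0..n})"

definition normalized_max_runs :: "nat \<Rightarrow> (nat \<Rightarrow> nat) \<Rightarrow> real" where
  "normalized_max_runs n \<sigma> = real n powr (-1/2) * (real (max_runs n \<sigma>) - real n / 4)"

(* The second parameter is the variance, whereas that of normal_density is the
   standard deviation. *)
definition normal_law :: "real \<Rightarrow> real \<Rightarrow> real measure" where
  "normal_law \<mu> v = density lborel (normal_density \<mu> (sqrt v))"

end

(*
  If the number m of flipped sites is itself Bin(n, 1/2), the string consists of independent
  fair bits. The indicators of a change between consecutive bits (starting from a 0) are then
  also independent and fair, so the number C of changes is Bin(n, 1/2), and the number
  of runs is C/2 rounded up. This gives the limit law, the moments of C
  following from a recursion for the simple random walk.

  It remains to see that the maximum over all m exceeds the value at this random m by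
  o(sqrt n), outside an event of superpolynomially small probability. By a union bound this
  concerns two fixed times m and j with j within n^(3/5) of n/2. The joint law of the two strings
  is that of independent letters conditioned on their frequencies, and this conditioning costs
  only a polynomial factor. For independent letters an exponential moment
  bound applies, in which the drop n (m/n - 1/2)^2 of the mean away from n/2 absorbs
  the growth of the variance in |m - j|.
*)
theory Submission
  imports Defs "HOL-Real_Asymp.Real_Asymp"
begin

section \<open>Uniform permutations and label strings\<close>

text \<open>The time of the maximum depends on \<sigma>, so no fixed-time law applies to it. The
  comparison takes place on the product space of an independent binomial time and the permutation,
  and the maximising time is removed by summing over all n + 1 candidates. The competing time is not
  confined to the middle. If the frequencies of ones at the competing and the reference time lie at
  distances d and f from 1/2, the mean numbers of runs differ by about n (f^2 - d^2), while the
  quadratic term of the exponential moment costs at most 4 t^2 n (d + f). As t d^2 - 4 t^2 d + 4 t^3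
  = t (d - 2 t)^2, the distance d drops out and one bound serves every competitor. With t = n^(-2/5)
  the remaining cost has order n t^3 = n^(-1/5), against a gain \<epsilon> t sqrt n = \<epsilon>
  n^(1/10); the window n^(3/5) is n t, and it is left with probability at most 2 exp(-2 n^(1/5)).
  Any t = n^(-a) with 1/4 < a < 1/2 would balance these terms. Superpolynomial smallness beats both
  the price of conditioning and n^r, the crude bound for an r-th power on the exceptional event; the
  latter is what gives all moments.\<close>

definition label_string :: "nat \<Rightarrow> (nat \<Rightarrow> 'a) \<Rightarrow> (nat \<Rightarrow> nat) \<Rightarrow> 'a list" where
  "label_string n c \<sigma> = map (\<lambda>k. c (inv \<sigma> k)) [1..<Suc n]"

lemma map_eq_map_upt_iff:
  "map f [1..<Suc n] = map g [1..<Suc n] \<longleftrightarrow> (\<forall>k\<in>{1..n}. f k = g k)"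
  by (auto simp del: upt_Suc)

lemma list_as_map_upt: "l = map (\<lambda>k. l ! (k - 1)) [1..<Suc (length l)]"
  by (rule nth_equalityI) (auto simp del: upt_Suc)

lemma finite_permutations_interval: "finite {\<sigma>. \<sigma> permutes {1..n::nat}}"
  by (simp add: finite_permutations)

lemma permutations_interval_ne: "{\<sigma>. \<sigma> permutes {1..n::nat}} \<noteq> {}"
  using permutes_id by blast

lemma set_uniform_perm: "set_pmf (uniform_perm n) = {\<sigma>. \<sigma> permutes {1..n}}"
  unfolding uniform_perm_def
  by (rule set_pmf_of_set[OF permutations_interval_ne finite_permutations_interval])

lemma map_uniform_perm_compose:
  assumes "q permutes {1..n}"
  shows "map_pmf (\<lambda>\<sigma>. q \<circ> \<sigma>) (uniform_perm n) = uniform_perm n"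
proof -
  have "inj_on (\<lambda>\<sigma>. q \<circ> \<sigma>) {\<sigma>. \<sigma> permutes {1..n}}"
    by (rule inj_onI) (use permutes_inj[OF assms] in \<open>auto simp: fun_eq_iff inj_def\<close>)
  moreover have "(\<lambda>\<sigma>. q \<circ> \<sigma>) ` {\<sigma>. \<sigma> permutes {1..n}} = {\<sigma>. \<sigma> permutes {1..n}}"
    using image_compose_permutations_left[OF assms] by (auto simp: image_def)
  ultimately show ?thesis
    unfolding uniform_perm_def
    using map_pmf_of_set_inj[OF _ permutations_interval_ne finite_permutations_interval] by metis
qed

lemma pmf_eq_pmf_of_set_if_constant:
  assumes "finite A" "A \<noteq> {}" "set_pmf p \<subseteq> A" "\<And>x y. x \<in> A \<Longrightarrow> y \<in> A \<Longrightarrow> pmf p x = pmf p y"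
  shows "p = pmf_of_set A"
proof (rule pmf_eqI)
  fix x
  have tot: "(\<Sum>y\<in>A. pmf p y) = 1"
    by (rule sum_pmf_eq_1[OF assms(1,3)])
  show "pmf p x = pmf (pmf_of_set A) x"
  proof (cases "x \<in> A")
    case True
    have "(\<Sum>y\<in>A. pmf p y) = (\<Sum>y\<in>A. pmf p x)"
      using assms(4)[OF _ True] by (intro sum.cong refl)
    then have "real (card A) * pmf p x = 1" using tot by simp
    then show ?thesis
      using True assms(1,2) by (simp add: field_simps)
  next
    case False
    then have "x \<notin> set_pmf p" using assms(3) by blast
    then show ?thesis using False assms(1,2) by (simp add: set_pmf_iff)
  qed
qed

text \<open>Two rearrangements \<open>l\<close>, \<open>l'\<close> of one multiset differ by a
  permutation \<open>q\<close> of the positions, and composing \<sigma> with \<open>inv q\<close>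
  preserves the uniform law while carrying one event to the other. Since
  \<open>inv \<sigma> k\<close> is the time at which site \<open>k\<close> changes, \<open>c\<close>
  colours times; a pair-valued \<open>c\<close> gives the joint law of the strings at two
  times.\<close>

lemma map_pmf_label_string:
  fixes c :: "nat \<Rightarrow> 'a"
  shows "map_pmf (label_string n c) (uniform_perm n)
    = pmf_of_set (permutations_of_multiset (image_mset c (mset_set {1..n})))"
proof (rule pmf_eq_pmf_of_set_if_constant)
  let ?A = "image_mset c (mset_set {1..n})"
  show "set_pmf (map_pmf (label_string n c) (uniform_perm n)) \<subseteq> permutations_of_multiset ?A"
  proof (clarsimp simp: set_uniform_perm permutations_of_multiset_def)
    fix \<sigma> assume s: "\<sigma> permutes {Suc 0..n}"
    have "image_mset (inv \<sigma>) (mset_set {1..n}) = mset_set (inv \<sigma> ` {1..n})"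
      using permutes_inj[OF permutes_inv[OF s]] by (intro image_mset_mset_set) (auto simp: inj_on_def)
    also have "\<dots> = mset_set {1..n}"
      using permutes_image[OF permutes_inv[OF s]] by simp
    finally have *: "image_mset (inv \<sigma>) (mset_set {1..n}) = mset_set {1..n}" .
    have "mset (label_string n c \<sigma>) = image_mset c (image_mset (inv \<sigma>) (mset_set {1..n}))"
      by (simp add: label_string_def mset_map image_mset.compositionality o_def
          atLeastLessThanSuc_atLeastAtMost del: upt_Suc)
    then show "mset (label_string n c \<sigma>) = image_mset c (mset_set {Suc 0..n})"
      using * by simp
  qed
next
  let ?A = "image_mset c (mset_set {1..n})"
  fix l l' assume l: "l \<in> permutations_of_multiset ?A" and l': "l' \<in> permutations_of_multiset ?A"
  define g where "g = (\<lambda>k. l ! (k - 1))"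
  define g' where "g' = (\<lambda>k. l' ! (k - 1))"
  have len: "length l = n" "length l' = n"
    using length_finite_permutations_of_multiset[OF l] length_finite_permutations_of_multiset[OF l']
    by auto
  have lg: "l = map g [1..<Suc n]" "l' = map g' [1..<Suc n]"
    using list_as_map_upt[of l] list_as_map_upt[of l'] len unfolding g_def g'_def by simp_all
  have "image_mset g (mset_set {1..n}) = mset l" "image_mset g' (mset_set {1..n}) = mset l'"
    by (simp_all add: lg mset_map atLeastLessThanSuc_atLeastAtMost del: upt_Suc)
  then have "image_mset g (mset_set {1..n}) = image_mset g' (mset_set {1..n})"
    using l l' by (simp add: permutations_of_multiset_def)
  then obtain q where q: "q permutes {1..n}" "\<forall>x\<in>{1..n}. g x = g' (q x)"
    using image_mset_eq_implies_permutes[of "{1..n}" g g'] by auto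
  have qq: "inv q permutes {1..n}" by (rule permutes_inv[OF q(1)])
  have iff: "label_string n c (inv q \<circ> \<sigma>) = l \<longleftrightarrow> label_string n c \<sigma> = l'"
    if s: "\<sigma> permutes {1..n}" for \<sigma>
  proof -
    have i: "inv (inv q \<circ> \<sigma>) = inv \<sigma> \<circ> q"
      using permutes_bij[OF s] permutes_bij[OF qq] permutes_bij[OF q(1)]
      by (simp add: o_inv_distrib inv_inv_eq)
    have "label_string n c (inv q \<circ> \<sigma>) = l \<longleftrightarrow> (\<forall>k\<in>{1..n}. c (inv \<sigma> (q k)) = g' (q k))"
      unfolding label_string_def lg map_eq_map_upt_iff i using q(2) by auto
    also have "\<dots> \<longleftrightarrow> (\<forall>k\<in>q ` {1..n}. c (inv \<sigma> k) = g' k)" by blast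
    also have "\<dots> \<longleftrightarrow> label_string n c \<sigma> = l'"
      unfolding label_string_def lg map_eq_map_upt_iff permutes_image[OF q(1)] ..
    finally show ?thesis .
  qed
  have "pmf (map_pmf (label_string n c) (uniform_perm n)) l
      = pmf (map_pmf (label_string n c) (map_pmf (\<lambda>\<sigma>. inv q \<circ> \<sigma>) (uniform_perm n))) l"
    by (simp only: map_uniform_perm_compose[OF qq])
  also have "\<dots> = measure (uniform_perm n) {\<sigma>. label_string n c (inv q \<circ> \<sigma>) = l}"
    by (simp add: map_pmf_comp pmf_map vimage_def)
  also have "\<dots> = measure (uniform_perm n) {\<sigma>. label_string n c \<sigma> = l'}"
    by (rule measure_pmf.finite_measure_eq_AE)
      (use iff in \<open>auto simp: AE_measure_pmf_iff set_uniform_perm\<close>)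
  also have "\<dots> = pmf (map_pmf (label_string n c) (uniform_perm n)) l'"
    by (simp add: pmf_map vimage_def)
  finally show "pmf (map_pmf (label_string n c) (uniform_perm n)) l
      = pmf (map_pmf (label_string n c) (uniform_perm n)) l'" .
qed auto

section \<open>Runs and changes of bit strings\<close>

text \<open>The flag is the bit preceding the list. Starting from \<open>False\<close> puts a
  virtual zero in front of the string, which accounts for the separate first term of
  \<open>num_runs\<close>.\<close>

fun runs :: "bool \<Rightarrow> bool list \<Rightarrow> nat" where
  "runs b [] = 0"
| "runs b (x # l) = of_bool (\<not> b \<and> x) + runs x l"

fun changes :: "bool \<Rightarrow> bool list \<Rightarrow> nat" where
  "changes b [] = 0"
| "changes b (x # l) = of_bool (b \<noteq> x) + changes x l"

text \<open>Upward and downward changes alternate, and only the upward ones open a run. The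
  preceding bit decides which kind comes first, hence the direction of rounding.\<close>

lemma runs_eq_changes:
  "runs b l = (if b then changes b l div 2 else (changes b l + 1) div 2)"
  by (induction l arbitrary: b) auto

lemma runs_le_length: "runs b l \<le> length l"
  by (induction l arbitrary: b) (auto simp: of_bool_def le_SucI)

lemma changes_le_length: "changes b l \<le> length l"
  by (induction l arbitrary: b) (auto simp: of_bool_def le_SucI)

lemma runs_map_upt:
  "runs b (map f [a..<a + Suc n])
    = of_bool (\<not> b \<and> f a) + (\<Sum>k = a..<a + n. of_bool (\<not> f k \<and> f (Suc k)))"
proof (induction n arbitrary: a b)
  case (Suc n)
  have "[a..<a + Suc (Suc n)] = a # [Suc a..<Suc a + Suc n]"
    by (simp add: upt_rec)
  moreover have "(\<Sum>k = a..<a + Suc n. of_bool (\<not> f k \<and> f (Suc k)))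
      = of_bool (\<not> f a \<and> f (Suc a)) + (\<Sum>k = Suc a..<Suc a + n. of_bool (\<not> f k \<and> f (Suc k)) :: nat)"
    by (subst sum.atLeast_Suc_lessThan) auto
  ultimately show ?case
    by (simp only: list.map runs.simps Suc.IH)
qed simp

definition bit_string :: "nat \<Rightarrow> nat \<Rightarrow> (nat \<Rightarrow> nat) \<Rightarrow> bool list" where
  "bit_string n m = label_string n (\<lambda>i. i \<le> m)"

lemma num_runs_eq_runs:
  assumes "n \<ge> 1"
  shows "num_runs n \<sigma> m = runs False (bit_string n m \<sigma>)"
proof -
  obtain k where k: "n = Suc k" using assms by (cases n) auto
  have "[1..<Suc n] = [1..<1 + Suc k]" by (simp add: k)
  moreover have "{1..n - 1} = {1..<1 + k}" by (auto simp: k)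
  moreover have "(\<Sum>k = 1..<1 + k. (1 - I_ind \<sigma> m k) * I_ind \<sigma> m (k + 1))
      = (\<Sum>k = 1..<1 + k. of_bool (\<not> inv \<sigma> k \<le> m \<and> inv \<sigma> (Suc k) \<le> m))"
    by (intro sum.cong) (auto simp: I_ind_def)
  ultimately show ?thesis
    unfolding num_runs_def bit_string_def label_string_def
    by (simp only: runs_map_upt) (simp add: I_ind_def)
qed

lemma length_label_string [simp]: "length (label_string n c \<sigma>) = n"
  by (simp add: label_string_def)

section \<open>Rearrangements versus independent letters\<close>

lemma pmf_replicate_pmf:
  "pmf (replicate_pmf n p) l = (if length l = n then (\<Prod>x\<leftarrow>l. pmf p x) else 0)"
proof (induction n arbitrary: l)
  case (Suc n)
  have *: "replicate_pmf (Suc n) p = map_pmf (\<lambda>(x, xs). x # xs) (pair_pmf p (replicate_pmf n p))"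
    by (simp add: pair_pmf_def map_pmf_def bind_assoc_pmf bind_return_pmf)
  show ?case
  proof (cases l)
    case Nil
    then show ?thesis
      by (auto simp: pmf_eq_0_set_pmf set_replicate_pmf simp del: replicate_pmf.simps)
  next
    case (Cons x xs)
    have "inj (\<lambda>(x, xs). x # (xs :: 'a list))" by (auto simp: inj_def)
    from pmf_map_inj'[OF this, of "pair_pmf p (replicate_pmf n p)" "(x, xs)"]
    show ?thesis using Suc.IH[of xs] by (simp add: * Cons pmf_pair del: replicate_pmf.simps)
  qed
qed (auto simp: indicator_def)

lemma prod_list_map_eq_prod_count:
  "(\<Prod>x\<leftarrow>l. f x :: real) = (\<Prod>x\<in>set_mset (mset l). f x ^ count (mset l) x)"
  by (simp add: image_prod_mset_multiplicity prod_mset_prod_list[symmetric])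

text \<open>This is (1 - 1/N)^N <= 1/e for N = a + 1, cleared of denominators; it drives the
  induction for the factorial bound below.\<close>

lemma exp_mult_power_le: "exp 1 * real a ^ Suc a \<le> real (Suc a) ^ Suc a"
proof -
  have "1 + (- 1 / real (Suc a)) \<le> exp (- 1 / real (Suc a))"
    by (rule exp_ge_add_one_self)
  moreover have "1 + (- 1 / real (Suc a)) = real a / real (Suc a)"
    by (simp add: field_simps)
  ultimately have "(real a / real (Suc a)) ^ Suc a \<le> exp (- 1 / real (Suc a)) ^ Suc a"
    by (intro power_mono) auto
  also have "\<dots> = exp (- 1)"
    by (simp only: exp_of_nat_mult[symmetric]) simp
  finally have "real a ^ Suc a / real (Suc a) ^ Suc a \<le> exp (- 1)"
    by (simp only: power_divide)
  then have "real a ^ Suc a \<le> exp (- 1) * real (Suc a) ^ Suc a"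
    by (subst (asm) pos_divide_le_eq) auto
  then have "exp 1 * real a ^ Suc a \<le> exp 1 * (exp (- 1) * real (Suc a) ^ Suc a)"
    by (intro mult_left_mono) auto
  also have "\<dots> = real (Suc a) ^ Suc a"
    by (simp only: mult.assoc[symmetric] exp_minus) simp
  finally show ?thesis .
qed

text \<open>For N = a + 1 this reads N! <= e N (N/e)^N, which is Stirling's formula up to a
  polynomial factor.\<close>

lemma fact_Suc_upper_bound: "exp (real a) * fact (Suc a) \<le> real (Suc a) ^ Suc (Suc a)"
proof (induction a)
  case (Suc a)
  have "exp (real (Suc a)) * fact (Suc (Suc a)) = exp 1 * real (Suc (Suc a)) * (exp (real a) * fact (Suc a))"
    by (simp add: exp_add algebra_simps del: fact_Suc) (simp add: algebra_simps)
  also have "\<dots> \<le> exp 1 * real (Suc (Suc a)) * real (Suc a) ^ Suc (Suc a)"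
    by (intro mult_left_mono Suc.IH) auto
  also have "\<dots> = real (Suc (Suc a)) * (exp 1 * real (Suc a) ^ Suc (Suc a))"
    by simp
  also have "\<dots> \<le> real (Suc (Suc a)) * real (Suc (Suc a)) ^ Suc (Suc a)"
    by (intro mult_left_mono exp_mult_power_le) auto
  finally show ?case by simp
qed simp

lemma fact_upper_bound: "exp (real a) * fact a \<le> exp 1 * real (Suc a) * real a ^ a"
proof (cases a)
  case (Suc b)
  have "exp (real a) * fact a = exp 1 * (exp (real b) * fact (Suc b))"
    by (simp add: Suc exp_add)
  also have "\<dots> \<le> exp 1 * (real (Suc b) * real (Suc b) ^ Suc b)"
    using fact_Suc_upper_bound[of b] by (intro mult_left_mono) auto
  also have "\<dots> \<le> exp 1 * (real (Suc a) * real a ^ a)"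
    unfolding Suc by (intro mult_left_mono mult_right_mono) auto
  finally show ?thesis by simp
qed (use exp_ge_add_one_self[of 1] in simp)

text \<open>The quotient n^n / n! is a single term of the exponential series at n.\<close>

lemma fact_lower_bound: "real n ^ n \<le> exp (real n) * fact n"
proof -
  have "(\<Sum>k\<in>{n}. inverse (fact k) * real n ^ k) \<le> (\<Sum>k. inverse (fact k) * real n ^ k)"
    by (rule sum_le_suminf) (auto intro: summable_exp)
  also have "\<dots> = exp (real n)" by (simp add: exp_def divide_inverse mult.commute)
  finally show ?thesis by (simp add: field_simps)
qed

text \<open>
  A string of independent letters drawn with the frequencies of \<open>A\<close> is a rearrangement
  of \<open>A\<close> with at least polynomial probability, by Stirling-type bounds.
\<close>
lemma prob_permutations_of_multiset_le:
  assumes A: "A \<noteq> {#}"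
  shows "measure (pmf_of_set (permutations_of_multiset A)) E
    \<le> (exp 1 * real (Suc (size A))) ^ card (set_mset A)
       * measure (replicate_pmf (size A) (pmf_of_multiset A)) E"
proof -
  define n where "n = size A"
  define P where "P = permutations_of_multiset A"
  define N where "N = real (card P)"
  \<comment> \<open>The probability of one particular rearrangement of \<open>A\<close> under
    independent letters; it depends on the letter counts only, so it is the same for all of
    them.\<close>
  define w where "w = (\<Prod>x\<in>set_mset A. (real (count A x) / real n) ^ count A x)"
  define K where "K = (exp 1 * real (Suc n)) ^ card (set_mset A)"
  have fin: "finite P" and ne: "P \<noteq> {}" by (simp_all add: P_def)
  have n: "n > 0" using A by (simp add: n_def nonempty_has_size)
  have N: "N > 0" using fin ne by (simp add: N_def card_gt_0_iff)
  have len: "length l = n" and ml: "mset l = A" if "l \<in> P" for l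
    using that length_finite_permutations_of_multiset by (auto simp: P_def n_def permutations_of_multiset_def)
  have pl: "pmf (replicate_pmf n (pmf_of_multiset A)) l = w" if "l \<in> P" for l
    using that by (simp add: pmf_replicate_pmf len prod_list_map_eq_prod_count ml w_def A n_def)
  have "(\<Prod>x\<in>set_mset A. exp (real (count A x)) * fact (count A x))
      \<le> (\<Prod>x\<in>set_mset A. exp 1 * real (Suc n) * real (count A x) ^ count A x)"
  proof (rule prod_mono, intro conjI)
    fix x assume "x \<in># A"
    have "exp (real (count A x)) * fact (count A x)
        \<le> exp 1 * real (Suc (count A x)) * real (count A x) ^ count A x"
      by (rule fact_upper_bound)
    also have "\<dots> \<le> exp 1 * real (Suc n) * real (count A x) ^ count A x"
      using count_le_size[of A x] by (intro mult_left_mono mult_right_mono) (auto simp: n_def)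
    finally show "exp (real (count A x)) * fact (count A x)
        \<le> exp 1 * real (Suc n) * real (count A x) ^ count A x" .
  qed simp
  then have 1: "exp (real n) * (\<Prod>x\<in>set_mset A. fact (count A x))
      \<le> K * (\<Prod>x\<in>set_mset A. real (count A x) ^ count A x)"
    by (simp add: prod.distrib K_def n_def size_multiset_overloaded_eq flip: exp_sum of_nat_sum)
  have 2: "(\<Prod>x\<in>set_mset A. real (count A x) ^ count A x) = w * real n ^ n"
  proof -
    have "(\<Prod>x\<in>set_mset A. real n ^ count A x) = real n ^ n"
      by (simp only: power_sum[symmetric] size_multiset_overloaded_eq[symmetric] n_def)
    then show ?thesis using n by (simp add: w_def power_divide prod_dividef)
  qed
  have F: "N * (\<Prod>x\<in>set_mset A. fact (count A x)) = fact n"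
    using arg_cong[OF card_permutations_of_multiset_aux[of A], of real] by (simp add: N_def P_def n_def)
  have "real n ^ n \<le> exp (real n) * fact n" by (rule fact_lower_bound)
  also have "\<dots> = N * (exp (real n) * (\<Prod>x\<in>set_mset A. fact (count A x)))"
    using F by (simp add: algebra_simps)
  also have "\<dots> \<le> N * (K * (w * real n ^ n))"
    using 1 N by (intro mult_left_mono) (auto simp: 2)
  finally have "1 * real n ^ n \<le> (N * K * w) * real n ^ n" by (simp add: algebra_simps)
  \<comment> \<open>Here \<open>N * w\<close> is the probability that the independent string is a
    rearrangement of \<open>A\<close>; it is at least 1/K.\<close>
  then have "1 \<le> N * K * w" using n by (subst (asm) mult_le_cancel_right) auto
  then have Nw: "1 / N \<le> K * w" using N by (simp add: field_simps)
  have "measure (pmf_of_set P) E = (\<Sum>l\<in>P \<inter> E. 1 / N)"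
    using fin ne by (simp add: measure_pmf_of_set N_def)
  also have "\<dots> \<le> (\<Sum>l\<in>P \<inter> E. K * w)" by (intro sum_mono Nw)
  also have "\<dots> = (\<Sum>l\<in>P \<inter> E. K * pmf (replicate_pmf n (pmf_of_multiset A)) l)"
    by (intro sum.cong) (auto simp: pl)
  also have "\<dots> = K * measure (replicate_pmf n (pmf_of_multiset A)) (P \<inter> E)"
    using fin by (subst measure_measure_pmf_finite) (auto simp: sum_distrib_left)
  also have "\<dots> \<le> K * measure (replicate_pmf n (pmf_of_multiset A)) E"
    by (intro mult_left_mono measure_pmf.finite_measure_mono) (auto simp: K_def)
  finally show ?thesis by (simp add: P_def n_def K_def)
qed

section \<open>Exponential bounds for sums over adjacent letters\<close>

lemma expectation_bind_pmf_finite: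
  fixes h :: "'b \<Rightarrow> 'c::{banach, second_countable_topology}"
  assumes "finite (set_pmf p)" "\<And>x. x \<in> set_pmf p \<Longrightarrow> finite (set_pmf (f x))"
  shows "measure_pmf.expectation (p \<bind> f) h
    = measure_pmf.expectation p (\<lambda>x. measure_pmf.expectation (f x) h)"
  using assms by (subst pmf_expectation_bind[of "set_pmf p"]) (auto simp: integral_measure_pmf[of "set_pmf p"])

lemma finite_set_replicate_pmf:
  assumes "finite (set_pmf p)" shows "finite (set_pmf (replicate_pmf n p))"
  unfolding set_replicate_pmf using finite_lists_length_eq[OF assms, of n] by (simp add: lists_eq_set)

lemma expectation_replicate_pmf_Suc:
  fixes F :: "'a list \<Rightarrow> 'c::{banach, second_countable_topology}"
  assumes "finite (set_pmf p)"
  shows "measure_pmf.expectation (replicate_pmf (Suc n) p) F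
    = measure_pmf.expectation p (\<lambda>x. measure_pmf.expectation (replicate_pmf n p) (\<lambda>l. F (x # l)))"
  using assms finite_set_replicate_pmf[OF assms, of n]
  by (simp add: expectation_bind_pmf_finite)

fun adjacent_sum :: "('a \<Rightarrow> 'a \<Rightarrow> real) \<Rightarrow> 'a list \<Rightarrow> real" where
  "adjacent_sum Y (x # y # l) = Y x y + adjacent_sum Y (y # l)"
| "adjacent_sum Y _ = 0"

text \<open>The pairs are disjoint, so under independent letters the summands are independent. The
  adjacent pairs left out are the disjoint pairs of the tail.\<close>

fun pair_sum :: "('a \<Rightarrow> 'a \<Rightarrow> real) \<Rightarrow> 'a list \<Rightarrow> real" where
  "pair_sum Y (x # y # l) = Y x y + pair_sum Y l"
| "pair_sum Y _ = 0"

lemma adjacent_sum_eq: "adjacent_sum Y l = pair_sum Y l + pair_sum Y (tl l)"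
  by (induction Y l rule: adjacent_sum.induct) auto

lemma expectation_exp_pair_sum:
  assumes p: "finite (set_pmf p)"
  shows "measure_pmf.expectation (replicate_pmf n p) (\<lambda>l. exp (t * pair_sum Y l))
    = measure_pmf.expectation p (\<lambda>x. measure_pmf.expectation p (\<lambda>y. exp (t * Y x y))) ^ (n div 2)"
proof (induction n rule: induct_nat_012)
  case 1
  then show ?case by (subst expectation_replicate_pmf_Suc[OF p]) simp
next
  case (ge2 n)
  then show ?case
    by (simp add: expectation_replicate_pmf_Suc[OF p] distrib_left exp_add del: replicate_pmf.simps)
qed simp

lemma exp_le_quadratic:
  assumes "\<bar>x :: real\<bar> \<le> 1"
  shows "exp x \<le> 1 + x + x\<^sup>2"
proof (cases "x \<ge> 0")
  case False
  have "1 \<le> (1 - x) * (1 + x + x\<^sup>2)"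
  proof -
    have "(1 - x) * (1 + x + x\<^sup>2) = 1 - x ^ 3" by (simp add: algebra_simps power2_eq_square power3_eq_cube)
    moreover have "x ^ 3 \<le> 0" using False by (simp add: power_le_zero_eq)
    ultimately show ?thesis by simp
  qed
  also have "\<dots> \<le> exp (- x) * (1 + x + x\<^sup>2)"
    using exp_ge_add_one_self[of "- x"] assms zero_le_power2[of x] by (intro mult_right_mono) linarith+
  finally show ?thesis by (simp add: exp_minus field_simps)
qed (use assms exp_bound in auto)

text \<open>The second moment is kept instead of the trivial bound 1: for strings at nearby times it
  is small, and the whole gain comes from that.\<close>

lemma expectation_exp_le:
  fixes Y :: "'a \<Rightarrow> 'a \<Rightarrow> real"
  assumes p: "finite (set_pmf p)" and Y: "\<And>x y. \<bar>Y x y\<bar> \<le> 1" and t: "0 \<le> t" "t \<le> 1"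
  shows "measure_pmf.expectation p (\<lambda>x. measure_pmf.expectation p (\<lambda>y. exp (t * Y x y)))
    \<le> exp (t * measure_pmf.expectation p (\<lambda>x. measure_pmf.expectation p (\<lambda>y. Y x y))
         + t\<^sup>2 * measure_pmf.expectation p (\<lambda>x. measure_pmf.expectation p (\<lambda>y. (Y x y)\<^sup>2)))"
proof -
  note [simp] = integrable_measure_pmf_finite[OF p]
  have e: "exp (t * Y x y) \<le> 1 + t * Y x y + t\<^sup>2 * (Y x y)\<^sup>2" for x y
  proof -
    have "\<bar>t * Y x y\<bar> \<le> 1 * 1" unfolding abs_mult using t Y by (intro mult_mono) auto
    then show ?thesis using exp_le_quadratic[of "t * Y x y"] by (simp add: power_mult_distrib)
  qed
  have "measure_pmf.expectation p (\<lambda>x. measure_pmf.expectation p (\<lambda>y. exp (t * Y x y)))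
    \<le> measure_pmf.expectation p (\<lambda>x. measure_pmf.expectation p (\<lambda>y. 1 + t * Y x y + t\<^sup>2 * (Y x y)\<^sup>2))"
    by (intro integral_mono e) auto
  also have "\<dots> = 1 + (t * measure_pmf.expectation p (\<lambda>x. measure_pmf.expectation p (\<lambda>y. Y x y))
         + t\<^sup>2 * measure_pmf.expectation p (\<lambda>x. measure_pmf.expectation p (\<lambda>y. (Y x y)\<^sup>2)))"
    by simp
  also have "\<dots> \<le> exp (t * measure_pmf.expectation p (\<lambda>x. measure_pmf.expectation p (\<lambda>y. Y x y))
         + t\<^sup>2 * measure_pmf.expectation p (\<lambda>x. measure_pmf.expectation p (\<lambda>y. (Y x y)\<^sup>2)))"
    by (rule exp_ge_add_one_self)
  finally show ?thesis .
qed

text \<open>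
  The summands at even and at odd positions are separately independent; convexity of the
  exponential function recombines the two halves.
\<close>
lemma prob_adjacent_sum_ge:
  assumes p: "finite (set_pmf p)" and Y: "\<And>x y. \<bar>Y x y\<bar> \<le> 1" and t: "0 \<le> t" "t \<le> 1 / 2"
  defines "\<mu> \<equiv> measure_pmf.expectation p (\<lambda>x. measure_pmf.expectation p (\<lambda>y. Y x y))"
  defines "v \<equiv> measure_pmf.expectation p (\<lambda>x. measure_pmf.expectation p (\<lambda>y. (Y x y)\<^sup>2))"
  shows "measure (replicate_pmf n p) {l. adjacent_sum Y l \<ge> s}
    \<le> exp (t * (real n * \<mu> + 2 - s) + 2 * t\<^sup>2 * real n * v)"
proof -
  \<comment> \<open>The factor 2 comes from e^(t(a + b)) <= (e^(2ta) + e^(2tb))/2, and the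
    hypothesis t <= 1/2 keeps 2t within the range of the quadratic bound.\<close>
  define \<rho> where "\<rho> = measure_pmf.expectation p (\<lambda>x. measure_pmf.expectation p (\<lambda>y. exp (2 * t * Y x y)))"
  define R where "R = exp (t * (real n * \<mu> + 2) + 2 * t\<^sup>2 * real n * v)"
  note int [simp] = integrable_measure_pmf_finite[OF p]
  note int' [simp] = integrable_measure_pmf_finite[OF finite_set_replicate_pmf[OF p]]
  have \<rho>: "0 \<le> \<rho>" "\<rho> \<le> exp (2 * t * \<mu> + 4 * t\<^sup>2 * v)"
    using expectation_exp_le[OF p Y, of "2 * t"] t
    by (auto simp: \<rho>_def \<mu>_def v_def power_mult_distrib intro!: integral_nonneg)
  have "v \<ge> 0" by (auto simp: v_def intro!: integral_nonneg)
  have absle: "\<bar>measure_pmf.expectation p f\<bar> \<le> 1" if "\<And>x. \<bar>f x\<bar> \<le> 1" for f :: "'a \<Rightarrow> real"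
  proof -
    have "\<bar>measure_pmf.expectation p f\<bar> \<le> measure_pmf.expectation p (\<lambda>x. \<bar>f x\<bar>)"
      by (rule integral_abs_bound)
    also have "\<dots> \<le> measure_pmf.expectation p (\<lambda>x. 1)"
      by (intro integral_mono) (use that in auto)
    finally show ?thesis by simp
  qed
  have \<mu>: "\<bar>\<mu>\<bar> \<le> 1" unfolding \<mu>_def by (intro absle Y)
  \<comment> \<open>\<open>N\<close> stands for the number of disjoint pairs in the full string or
    in its tail. The at most two letters not covered shift the mean by at most 2, whence the summand
    2 in \<open>R\<close>.\<close>
  have pow: "\<rho> ^ N \<le> R" if N: "2 * N \<le> n" "n \<le> 2 * N + 2" for N
  proof -
    have "\<rho> ^ N \<le> exp (2 * t * \<mu> + 4 * t\<^sup>2 * v) ^ N"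
      by (intro power_mono \<rho>)
    also have "\<dots> = exp (t * (2 * real N * \<mu>) + 2 * t\<^sup>2 * (2 * real N) * v)"
      by (simp add: exp_of_nat_mult[symmetric] algebra_simps)
    also have "\<dots> \<le> R"
    proof -
      have "(real n - 2 * real N) * \<mu> \<ge> (real n - 2 * real N) * (-1)"
        using N \<mu> by (intro mult_left_mono) linarith+
      then have "2 * real N * \<mu> \<le> real n * \<mu> + 2"
        using N by (simp add: algebra_simps)
      then have "t * (2 * real N * \<mu>) \<le> t * (real n * \<mu> + 2)"
        using t by (intro mult_left_mono)
      moreover have "2 * t\<^sup>2 * (2 * real N) * v \<le> 2 * t\<^sup>2 * real n * v"
        using N t \<open>v \<ge> 0\<close> by (intro mult_right_mono mult_left_mono) auto
      ultimately show ?thesis unfolding R_def by (simp only: exp_le_cancel_iff)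
    qed
    finally show ?thesis .
  qed
  have E1: "measure_pmf.expectation (replicate_pmf n p) (\<lambda>l. exp (2 * t * pair_sum Y l)) \<le> R"
    unfolding expectation_exp_pair_sum[OF p] \<rho>_def[symmetric] by (rule pow) linarith+
  have E2: "measure_pmf.expectation (replicate_pmf n p) (\<lambda>l. exp (2 * t * pair_sum Y (tl l))) \<le> R"
  proof (cases n)
    case 0
    then show ?thesis using t by (simp add: R_def)
  next
    case (Suc k)
    show ?thesis
      unfolding Suc expectation_replicate_pmf_Suc[OF p]
      using pow[of "k div 2"] Suc
      by (simp add: expectation_exp_pair_sum[OF p] \<rho>_def[symmetric])
  qed
  have conv: "exp (t * adjacent_sum Y l)
      \<le> (exp (2 * t * pair_sum Y l) + exp (2 * t * pair_sum Y (tl l))) / 2" for l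
  proof -
    define a where "a = exp (t * pair_sum Y l)"
    define b where "b = exp (t * pair_sum Y (tl l))"
    have "exp (2 * t * pair_sum Y l) = a\<^sup>2" "exp (2 * t * pair_sum Y (tl l)) = b\<^sup>2"
      by (simp_all add: a_def b_def power2_eq_square exp_add[symmetric])
    moreover have "exp (t * adjacent_sum Y l) = a * b"
      by (simp add: a_def b_def adjacent_sum_eq distrib_left exp_add)
    ultimately show ?thesis using sum_squares_bound[of a b] by simp
  qed
  have "measure (replicate_pmf n p) {l. adjacent_sum Y l \<ge> s}
      = measure_pmf.expectation (replicate_pmf n p) (indicator {l. adjacent_sum Y l \<ge> s})"
    by simp
  \<comment> \<open>Chernoff's bound: the indicator is dominated by exp(t (sum - s)), then by the
    average over the two halves.\<close>
  also have "\<dots> \<le> measure_pmf.expectation (replicate_pmf n p)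
      (\<lambda>l. exp (- t * s) * ((exp (2 * t * pair_sum Y l) + exp (2 * t * pair_sum Y (tl l))) / 2))"
  proof (intro integral_mono int')
    fix l
    show "indicator {l. adjacent_sum Y l \<ge> s} l
        \<le> exp (- t * s) * ((exp (2 * t * pair_sum Y l) + exp (2 * t * pair_sum Y (tl l))) / 2)"
    proof (cases "adjacent_sum Y l \<ge> s")
      case True
      then have "1 \<le> exp (t * (adjacent_sum Y l - s))" using t by simp
      also have "\<dots> = exp (- t * s) * exp (t * adjacent_sum Y l)"
        by (simp add: exp_add[symmetric] algebra_simps)
      also have "\<dots> \<le> exp (- t * s) * ((exp (2 * t * pair_sum Y l) + exp (2 * t * pair_sum Y (tl l))) / 2)"
        by (intro mult_left_mono conv) auto
      finally show ?thesis using True by simp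
    qed (auto intro!: mult_nonneg_nonneg add_nonneg_nonneg)
  qed
  also have "\<dots> = exp (- t * s) * ((measure_pmf.expectation (replicate_pmf n p) (\<lambda>l. exp (2 * t * pair_sum Y l))
      + measure_pmf.expectation (replicate_pmf n p) (\<lambda>l. exp (2 * t * pair_sum Y (tl l)))) / 2)"
    by simp
  also have "\<dots> \<le> exp (- t * s) * ((R + R) / 2)"
    by (intro mult_left_mono divide_right_mono add_mono E1 E2) auto
  also have "\<dots> = exp (t * (real n * \<mu> + 2 - s) + 2 * t\<^sup>2 * real n * v)"
    by (simp add: R_def exp_add[symmetric] algebra_simps)
  finally show ?thesis .
qed

text \<open>From the second letter on, a run start is a function of two adjacent letters; the
  leading 1 covers the first letter, which is compared with \<open>b\<close> and
  \<open>c\<close>.\<close>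

lemma runs_diff_le_adjacent_sum:
  "real (runs b (map fst l)) - real (runs c (map snd l))
    \<le> 1 + adjacent_sum (\<lambda>x y. of_bool (\<not> fst x \<and> fst y) - of_bool (\<not> snd x \<and> snd y)) l"
proof -
  let ?Y = "\<lambda>x y :: bool \<times> bool. of_bool (\<not> fst x \<and> fst y) - of_bool (\<not> snd x \<and> snd y) :: real"
  have *: "real (runs (fst x) (map fst l)) - real (runs (snd x) (map snd l)) = adjacent_sum ?Y (x # l)" for x l
    by (induction l arbitrary: x) auto
  show ?thesis
  proof (cases l)
    case (Cons x l')
    then show ?thesis using *[of x l'] by (auto simp: of_bool_def)
  qed simp
qed

lemma expectation_pmf_of_multiset_image:
  fixes f :: "'b \<Rightarrow> real"
  assumes "finite A" "A \<noteq> {}"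
  shows "measure_pmf.expectation (pmf_of_multiset (image_mset c (mset_set A))) f = (\<Sum>i\<in>A. f (c i)) / card A"
  using assms by (simp add: map_pmf_of_set[symmetric] integral_pmf_of_set)

text \<open>Both strings are read off one string of pairs of bits. There are four possible letters,
  which gives the exponent 4 in the price of replacing rearrangements by independent letters. The
  bound is uniform in \<open>m\<close>; only \<open>j\<close> has to be near n/2.\<close>

lemma prob_runs_difference_ge:
  assumes n: "n \<ge> 1" and mj: "m \<le> n" "j \<le> n" and t: "0 \<le> t" "t \<le> 1 / 2"
    and e: "\<bar>real j / real n - 1 / 2\<bar> \<le> e"
  shows "measure (uniform_perm n)
      {\<sigma>. real (runs False (bit_string n m \<sigma>)) - real (runs False (bit_string n j \<sigma>)) \<ge> s}
    \<le> (exp 1 * real (Suc n)) ^ 4 * exp (t * (3 - s) + real n * (t * e\<^sup>2 + 4 * t\<^sup>2 * e + 4 * t ^ 3))"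
proof -
  define c where "c = (\<lambda>i. (i \<le> m, i \<le> j))"
  define A where "A = image_mset c (mset_set {1..n})"
  define p where "p = pmf_of_multiset A"
  define Y where "Y = (\<lambda>x y :: bool \<times> bool. of_bool (\<not> fst x \<and> fst y) - of_bool (\<not> snd x \<and> snd y) :: real)"
  define \<alpha> where "\<alpha> = real m / real n"
  define \<beta> where "\<beta> = real j / real n"
  have A: "A \<noteq> {#}" using n by (simp add: A_def mset_set_empty_iff)
  have size: "size A = n" by (simp add: A_def)
  have E: "measure_pmf.expectation p f = (\<Sum>i = 1..n. f (c i)) / n" for f :: "_ \<Rightarrow> real"
    unfolding p_def A_def using n by (subst expectation_pmf_of_multiset_image) auto
  have fin: "finite (set_pmf p)" by (rule finite_subset[OF subset_UNIV]) simp
  note int = integrable_measure_pmf_finite[OF fin]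
  have cnt: "(\<Sum>i = 1..n. of_bool (i \<le> k)) = real k" if "k \<le> n" for k
  proof -
    have "{1..n} \<inter> {i. i \<le> k} = {1..k}" using that by auto
    then show ?thesis by simp
  qed
  have Efst: "measure_pmf.expectation p (\<lambda>x. of_bool (fst x)) = \<alpha>"
    using cnt[OF mj(1)] by (simp only: E c_def fst_conv \<alpha>_def)
  have Esnd: "measure_pmf.expectation p (\<lambda>x. of_bool (snd x)) = \<beta>"
    using cnt[OF mj(2)] by (simp only: E c_def snd_conv \<beta>_def)
  \<comment> \<open>The sets of ones at the two times are nested, so the indicator differences all
    have one sign and the absolute value can be taken after summing.\<close>
  have Ediff: "measure_pmf.expectation p (\<lambda>x. of_bool (fst x \<noteq> snd x)) = \<bar>\<alpha> - \<beta>\<bar>"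
  proof -
    have "of_bool ((i \<le> m) \<noteq> (i \<le> j)) = \<bar>of_bool (i \<le> m) - of_bool (i \<le> j) :: real\<bar>" for i by auto
    moreover have "(\<Sum>i = 1..n. \<bar>of_bool (i \<le> m) - of_bool (i \<le> j) :: real\<bar>)
        = \<bar>(\<Sum>i = 1..n. of_bool (i \<le> m) - of_bool (i \<le> j))\<bar>"
    proof (cases "m \<le> j")
      case True
      then have *: "\<bar>of_bool (i \<le> m) - of_bool (i \<le> j) :: real\<bar> = - (of_bool (i \<le> m) - of_bool (i \<le> j))" for i
        by auto
      have "of_bool (i \<le> m) - of_bool (i \<le> j) \<le> (0::real)" for i using True by auto
      then have "(\<Sum>i = 1..n. of_bool (i \<le> m) - of_bool (i \<le> j)) \<le> (0::real)" by (intro sum_nonpos)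
      then show ?thesis unfolding * sum_negf by simp
    next
      case False
      then have *: "\<bar>of_bool (i \<le> m) - of_bool (i \<le> j) :: real\<bar> = of_bool (i \<le> m) - of_bool (i \<le> j)" for i
        by auto
      have "of_bool (i \<le> m) - of_bool (i \<le> j) \<ge> (0::real)" for i using False by auto
      then have "(\<Sum>i = 1..n. of_bool (i \<le> m) - of_bool (i \<le> j)) \<ge> (0::real)" by (intro sum_nonneg)
      then show ?thesis unfolding * by simp
    qed
    moreover have "(\<Sum>i = 1..n. of_bool (i \<le> m) - of_bool (i \<le> j)) = real m - real j"
      by (simp only: sum_subtractf cnt mj)
    ultimately show ?thesis
      using n by (simp only: E c_def fst_conv snd_conv \<alpha>_def \<beta>_def) (simp add: diff_divide_distrib[symmetric])
  qed
  have Yexp: "Y x y = of_bool (fst y) - of_bool (snd y)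
      - of_bool (fst x) * of_bool (fst y) + of_bool (snd x) * of_bool (snd y)" for x y
    by (auto simp: Y_def)
  have mu: "measure_pmf.expectation p (\<lambda>x. measure_pmf.expectation p (\<lambda>y. Y x y))
      = \<alpha> - \<beta> - \<alpha>\<^sup>2 + \<beta>\<^sup>2"
    unfolding Yexp by (simp add: int Efst Esnd power2_eq_square)
  \<comment> \<open>If both letters have equal components, the two run-start indicators agree and
    \<open>Y\<close> vanishes.\<close>
  have Ysq: "(Y x y)\<^sup>2 \<le> of_bool (fst x \<noteq> snd x) + of_bool (fst y \<noteq> snd y)" for x y
    by (auto simp: Y_def of_bool_def)
  have add: "measure_pmf.expectation p (\<lambda>x. measure_pmf.expectation p (\<lambda>y. f x + g y))
      = measure_pmf.expectation p f + measure_pmf.expectation p g" for f g :: "_ \<Rightarrow> real"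
    by (simp add: int)
  have "measure_pmf.expectation p (\<lambda>x. measure_pmf.expectation p (\<lambda>y. (Y x y)\<^sup>2))
      \<le> measure_pmf.expectation p (\<lambda>x. measure_pmf.expectation p (\<lambda>y. of_bool (fst x \<noteq> snd x) + of_bool (fst y \<noteq> snd y)))"
    by (intro integral_mono Ysq int)
  also have "\<dots> = 2 * \<bar>\<alpha> - \<beta>\<bar>"
    unfolding add Ediff by simp
  finally have v: "measure_pmf.expectation p (\<lambda>x. measure_pmf.expectation p (\<lambda>y. (Y x y)\<^sup>2)) \<le> 2 * \<bar>\<alpha> - \<beta>\<bar>" .
  have bits: "bit_string n m \<sigma> = map fst (label_string n c \<sigma>)"
       "bit_string n j \<sigma> = map snd (label_string n c \<sigma>)" for \<sigma>
    by (simp_all add: bit_string_def label_string_def c_def)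
  have "measure (uniform_perm n)
      {\<sigma>. real (runs False (bit_string n m \<sigma>)) - real (runs False (bit_string n j \<sigma>)) \<ge> s}
    \<le> measure (uniform_perm n) (label_string n c -` {l. adjacent_sum Y l \<ge> s - 1})"
  proof (intro measure_pmf.finite_measure_mono subsetI)
    fix \<sigma> assume "\<sigma> \<in> {\<sigma>. real (runs False (bit_string n m \<sigma>)) - real (runs False (bit_string n j \<sigma>)) \<ge> s}"
    then show "\<sigma> \<in> label_string n c -` {l. adjacent_sum Y l \<ge> s - 1}"
      using runs_diff_le_adjacent_sum[of False "label_string n c \<sigma>" False] by (simp add: bits Y_def)
  qed simp
  also have "\<dots> = measure (pmf_of_set (permutations_of_multiset A)) {l. adjacent_sum Y l \<ge> s - 1}"
    by (simp only: A_def map_pmf_label_string[symmetric] measure_map_pmf)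
  also have "\<dots> \<le> (exp 1 * real (Suc (size A))) ^ card (set_mset A)
       * measure (replicate_pmf (size A) (pmf_of_multiset A)) {l. adjacent_sum Y l \<ge> s - 1}"
    by (rule prob_permutations_of_multiset_le[OF A])
  also have "\<dots> \<le> (exp 1 * real (Suc n)) ^ 4
      * exp (t * (3 - s) + real n * (t * e\<^sup>2 + 4 * t\<^sup>2 * e + 4 * t ^ 3))"
  proof (intro mult_mono)
    have "card (set_mset A) \<le> card (UNIV :: (bool \<times> bool) set)" by (intro card_mono) auto
    then have "card (set_mset A) \<le> 4" by simp
    moreover have "1 * 1 \<le> exp 1 * real (Suc n)" by (intro mult_mono) auto
    ultimately show "(exp 1 * real (Suc (size A))) ^ card (set_mset A) \<le> (exp 1 * real (Suc n)) ^ 4"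
      unfolding size by (intro power_increasing) auto
    have Y1: "\<bar>Y x y\<bar> \<le> 1" for x y by (auto simp: Y_def)
    have "measure (replicate_pmf n p) {l. adjacent_sum Y l \<ge> s - 1}
      \<le> exp (t * (real n * (\<alpha> - \<beta> - \<alpha>\<^sup>2 + \<beta>\<^sup>2) + 2 - (s - 1)) + 2 * t\<^sup>2 * real n *
         measure_pmf.expectation p (\<lambda>x. measure_pmf.expectation p (\<lambda>y. (Y x y)\<^sup>2)))"
      using prob_adjacent_sum_ge[OF fin, of Y t n "s - 1"] Y1 t unfolding mu by blast
    also have "\<dots> \<le> exp (t * (3 - s) + real n * (t * e\<^sup>2 + 4 * t\<^sup>2 * e + 4 * t ^ 3))"
    proof -
      define d where "d = \<bar>\<alpha> - 1 / 2\<bar>"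
      define f where "f = \<bar>\<beta> - 1 / 2\<bar>"
      define V where "V = measure_pmf.expectation p (\<lambda>x. measure_pmf.expectation p (\<lambda>y. (Y x y)\<^sup>2))"
      have f: "0 \<le> f" "f \<le> e" using e by (auto simp: f_def \<beta>_def)
      \<comment> \<open>Uses x (1 - x) = 1/4 - (x - 1/2)^2 for the probability of a run start at
        frequency x.\<close>
      have mu': "\<alpha> - \<beta> - \<alpha>\<^sup>2 + \<beta>\<^sup>2 = f\<^sup>2 - d\<^sup>2"
        by (simp add: f_def d_def power2_eq_square algebra_simps)
      have "V \<le> 2 * \<bar>\<alpha> - \<beta>\<bar>" unfolding V_def by (rule v)
      also have "\<dots> \<le> 2 * (d + f)"
        unfolding d_def f_def by (intro mult_left_mono) linarith+
      finally have "V \<le> 2 * (d + f)" .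
      then have V: "2 * t\<^sup>2 * V \<le> 2 * t\<^sup>2 * (2 * (d + f))"
        by (intro mult_left_mono) auto
      \<comment> \<open>Completing the square: the drop of the mean, \<open>t * d\<^sup>2\<close>,
        pays for the variance term linear in \<open>d\<close>, at the cost of
        \<open>4 * t ^ 3\<close>.\<close>
      have "t * d\<^sup>2 - 4 * t\<^sup>2 * d + 4 * t ^ 3 = t * (d - 2 * t)\<^sup>2"
        by (simp add: power2_eq_square power3_eq_cube algebra_simps)
      then have "t * d\<^sup>2 - 4 * t\<^sup>2 * d + 4 * t ^ 3 \<ge> 0" using t by simp
      moreover have "t * f\<^sup>2 \<le> t * e\<^sup>2" using f t by (intro mult_left_mono power_mono)
      moreover have "4 * t\<^sup>2 * f \<le> 4 * t\<^sup>2 * e" using f by (intro mult_left_mono) auto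
      ultimately have "t * (f\<^sup>2 - d\<^sup>2) + 2 * t\<^sup>2 * V \<le> t * e\<^sup>2 + 4 * t\<^sup>2 * e + 4 * t ^ 3"
        using V by (simp add: algebra_simps)
      then have "real n * (t * (f\<^sup>2 - d\<^sup>2) + 2 * t\<^sup>2 * V) \<le> real n * (t * e\<^sup>2 + 4 * t\<^sup>2 * e + 4 * t ^ 3)"
        by (intro mult_left_mono) auto
      then show ?thesis unfolding mu' V_def[symmetric] by (simp add: algebra_simps)
    qed
    finally show "measure (replicate_pmf (size A) (pmf_of_multiset A)) {l. adjacent_sum Y l \<ge> s - 1}
       \<le> exp (t * (3 - s) + real n * (t * e\<^sup>2 + 4 * t\<^sup>2 * e + 4 * t ^ 3))"
      by (simp add: size p_def)
  qed auto
  finally show ?thesis .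
qed

section \<open>Random number of ones\<close>

text \<open>Given m, the string is uniform among the strings with m ones. The factor
  \<open>n choose m\<close> cancels against the binomial weight, and only m equal to the number of
  ones in \<open>l\<close> contributes, leaving (1/2)^n.\<close>

lemma binomial_mixture_bit_string:
  "binomial_pmf n (1 / 2) \<bind> (\<lambda>m. map_pmf (bit_string n m) (uniform_perm n))
    = replicate_pmf n (bernoulli_pmf (1 / 2))"
proof (rule pmf_eqI)
  fix l :: "bool list"
  define A where "A = (\<lambda>m. image_mset (\<lambda>i. i \<le> m) (mset_set {1..n}))"
  define h where "h = count (mset l) True"
  have cT: "count (A m) True = m" and cF: "count (A m) False = n - m" if "m \<le> n" for m
  proof -
    have *: "count (A m) b = card {i \<in> {1..n}. (i \<le> m) = b}" for b
    proof -
      have "count (A m) b = (\<Sum>i\<in>(\<lambda>i. i \<le> m) -` {b} \<inter> {1..n}. 1)"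
        unfolding A_def count_image_mset by (intro sum.cong) auto
      also have "(\<lambda>i. i \<le> m) -` {b} \<inter> {1..n} = {i \<in> {1..n}. (i \<le> m) = b}" by blast
      finally show ?thesis by simp
    qed
    have "{i \<in> {1..n}. (i \<le> m) = True} = {1..m}" "{i \<in> {1..n}. (i \<le> m) = False} = {m<..n}"
      using that by auto
    then show "count (A m) True = m" "count (A m) False = n - m"
      unfolding * by (simp_all only: card_atLeastAtMost card_greaterThanAtMost)
  qed
  have size: "size (A m) = n" for m by (simp add: A_def)
  have card: "real (card (permutations_of_multiset (A m))) = real (n choose m)" if m: "m \<le> n" for m
  proof -
    \<comment> \<open>One of the two letters may be absent from \<open>A m\<close>; its factor is
      then 0! = 1, so the product can run over both.\<close>
    have "(\<Prod>x\<in>set_mset (A m). fact (count (A m) x)) = (\<Prod>x\<in>UNIV. fact (count (A m) x) :: nat)"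
      by (intro prod.mono_neutral_left) (auto simp: not_in_iff)
    then have "card (permutations_of_multiset (A m)) * (fact m * fact (n - m)) = fact n"
      using card_permutations_of_multiset_aux[of "A m"] m
      by (simp add: UNIV_bool cT cF mult_ac size)
    then have "real (card (permutations_of_multiset (A m))) * (fact m * fact (n - m)) = fact n"
      by (metis of_nat_fact of_nat_mult)
    then show ?thesis using m by (simp add: binomial_fact field_simps)
  qed
  have len: "length l = count (mset l) True + count (mset l) False"
    by (induction l) auto
  have mem: "mset l = A m \<longleftrightarrow> length l = n \<and> m = h" if m: "m \<le> n" for m
  proof
    assume "mset l = A m"
    then show "length l = n \<and> m = h" using m len by (simp add: h_def cT cF)
  next
    assume *: "length l = n \<and> m = h"
    show "mset l = A m"
    proof (rule multiset_eqI)
      fix b show "count (mset l) b = count (A m) b"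
        using * m len by (cases b) (auto simp: h_def cT cF)
    qed
  qed
  have p: "pmf (map_pmf (bit_string n m) (uniform_perm n)) l = of_bool (length l = n \<and> m = h) / real (n choose m)"
    if "m \<le> n" for m
  proof -
    have "pmf (map_pmf (bit_string n m) (uniform_perm n)) l
        = indicator (permutations_of_multiset (A m)) l / real (card (permutations_of_multiset (A m)))"
      unfolding bit_string_def map_pmf_label_string A_def by (rule pmf_of_set) auto
    then show ?thesis
      unfolding card[OF that] using mem[OF that] by (simp add: indicator_def permutations_of_multiset_def)
  qed
  have "pmf (binomial_pmf n (1 / 2) \<bind> (\<lambda>m. map_pmf (bit_string n m) (uniform_perm n))) l
      = (\<Sum>m\<le>n. real (n choose m) * (1 / 2) ^ m * (1 - 1 / 2) ^ (n - m) *
           (of_bool (length l = n \<and> m = h) / real (n choose m)))"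
    by (simp add: pmf_bind expectation_binomial_pmf' p)
  also have "\<dots> = (\<Sum>m\<le>n. if m = h then of_bool (length l = n) * (1 / 2) ^ n else 0)"
    by (intro sum.cong) (auto simp: power_add[symmetric] simp del: power_one_over)
  also have "\<dots> = of_bool (length l = n) * (1 / 2) ^ n"
    using len by (auto simp: h_def)
  also have "\<dots> = pmf (replicate_pmf n (bernoulli_pmf (1 / 2))) l"
  proof -
    have "pmf (bernoulli_pmf (1 / 2)) b = 1 / 2" for b by (cases b) simp_all
    then have "map (pmf (bernoulli_pmf (1 / 2))) l = map (\<lambda>_. 1 / 2) l" by simp
    then show ?thesis by (simp add: pmf_replicate_pmf map_replicate_const prod_list_replicate del: power_one_over)
  qed
  finally show "pmf (binomial_pmf n (1 / 2) \<bind> (\<lambda>m. map_pmf (bit_string n m) (uniform_perm n))) l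
    = pmf (replicate_pmf n (bernoulli_pmf (1 / 2))) l" .
qed

text \<open>Whatever the preceding bit, the first letter differs from it with probability 1/2. By
  induction the later changes have the same law after either letter, so they are independent of the
  first one.\<close>

lemma map_pmf_changes:
  "map_pmf (changes b) (replicate_pmf n (bernoulli_pmf (1 / 2))) = binomial_pmf n (1 / 2)"
proof (induction n arbitrary: b)
  case 0
  then show ?case by (simp add: binomial_pmf_0)
next
  case (Suc n)
  have flip: "map_pmf (\<lambda>x. b \<noteq> x) (bernoulli_pmf (1 / 2)) = bernoulli_pmf (1 / 2)"
  proof -
    have "bij (\<lambda>x. b \<noteq> x)" by (cases b) (auto simp: bij_def inj_def surj_def)
    then show ?thesis
      unfolding bernoulli_pmf_half_conv_pmf_of_set by (intro map_pmf_of_set_bij_betw) auto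
  qed
  have "map_pmf (changes b) (replicate_pmf (Suc n) (bernoulli_pmf (1 / 2)))
      = bernoulli_pmf (1 / 2) \<bind> (\<lambda>x. map_pmf (\<lambda>k. of_bool (b \<noteq> x) + k)
          (map_pmf (changes x) (replicate_pmf n (bernoulli_pmf (1 / 2)))))"
    by (simp add: map_bind_pmf map_pmf_comp map_pmf_def[symmetric])
  also have "\<dots> = map_pmf (\<lambda>x. b \<noteq> x) (bernoulli_pmf (1 / 2)) \<bind>
      (\<lambda>x. map_pmf (\<lambda>k. of_bool x + k) (binomial_pmf n (1 / 2)))"
    by (simp only: Suc.IH bind_map_pmf)
  also have "\<dots> = binomial_pmf (Suc n) (1 / 2)"
    unfolding flip by (simp add: binomial_pmf_Suc of_bool_def map_pmf_def)
  finally show ?case .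
qed

text \<open>Defined on pairs of a time and a permutation so that it lives on the same probability
  space as the maximum, which depends on the permutation alone.\<close>

definition change_count :: "nat \<Rightarrow> nat \<times> (nat \<Rightarrow> nat) \<Rightarrow> nat" where
  "change_count n = (\<lambda>(m, \<sigma>). changes False (bit_string n m \<sigma>))"

lemma map_pmf_change_count:
  "map_pmf (change_count n) (pair_pmf (binomial_pmf n (1 / 2)) (uniform_perm n)) = binomial_pmf n (1 / 2)"
proof -
  have "map_pmf (change_count n) (pair_pmf (binomial_pmf n (1 / 2)) (uniform_perm n))
      = map_pmf (changes False) (binomial_pmf n (1 / 2) \<bind> (\<lambda>m. map_pmf (bit_string n m) (uniform_perm n)))"
    by (simp add: pair_pmf_def change_count_def map_bind_pmf map_pmf_comp map_pmf_def bind_assoc_pmf bind_return_pmf)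
  then show ?thesis by (simp only: binomial_mixture_bit_string map_pmf_changes)
qed

section \<open>Moments of the simple random walk\<close>

text \<open>With s binomial, 2s - n is the simple random walk after n steps. The value type is left
  open to cover real moments and complex characteristic functions alike.\<close>

definition walk_expectation :: "nat \<Rightarrow> (real \<Rightarrow> 'c) \<Rightarrow> 'c::{banach, second_countable_topology, real_normed_field}" where
  "walk_expectation n g = measure_pmf.expectation (binomial_pmf n (1 / 2)) (\<lambda>s. g (2 * real s - real n))"

lemma walk_expectation_0 [simp]: "walk_expectation 0 g = g 0"
  by (simp add: walk_expectation_def binomial_pmf_0)

lemma walk_expectation_Suc:
  "walk_expectation (Suc n) g = (walk_expectation n (\<lambda>x. g (x + 1)) + walk_expectation n (\<lambda>x. g (x - 1))) / 2"
proof -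
  let ?B = "binomial_pmf n (1 / 2)"
  have fin: "finite (set_pmf (bernoulli_pmf (1 / 2)))" by (rule finite_subset[OF subset_UNIV]) simp
  have "walk_expectation (Suc n) g
    = measure_pmf.expectation (bernoulli_pmf (1 / 2) \<bind> (\<lambda>b. map_pmf (\<lambda>k. (if b then 1 else 0) + k) ?B))
        (\<lambda>s. g (2 * real s - real (Suc n)))"
    by (simp add: walk_expectation_def binomial_pmf_Suc map_pmf_def)
  also have "\<dots> = measure_pmf.expectation (bernoulli_pmf (1 / 2)) (\<lambda>b. measure_pmf.expectation
      (map_pmf (\<lambda>k. (if b then 1 else 0) + k) ?B) (\<lambda>s. g (2 * real s - real (Suc n))))"
    by (subst expectation_bind_pmf_finite[OF fin]) auto
  also have "\<dots> = (1 / 2) *\<^sub>R measure_pmf.expectation ?B (\<lambda>s. g (2 * real (1 + s) - real (Suc n)))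
      + (1 / 2) *\<^sub>R measure_pmf.expectation ?B (\<lambda>s. g (2 * real s - real (Suc n)))"
    by (subst integral_measure_pmf[of UNIV]) (auto simp: UNIV_bool)
  also have "\<dots> = (walk_expectation n (\<lambda>x. g (x + 1)) + walk_expectation n (\<lambda>x. g (x - 1))) / 2"
    by (simp add: walk_expectation_def algebra_simps scaleR_conv_of_real add_divide_distrib)
  finally show ?thesis .
qed

lemma walk_expectation_add:
  "walk_expectation n (\<lambda>x. f x + g x) = walk_expectation n f + walk_expectation n g"
  and walk_expectation_diff:
  "walk_expectation n (\<lambda>x. f x - g x) = walk_expectation n f - walk_expectation n g"
  and walk_expectation_cmult:
  "walk_expectation n (\<lambda>x. c * f x) = c * walk_expectation n f"
  by (simp_all add: walk_expectation_def)

lemma walk_expectation_sum: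
  "walk_expectation n (\<lambda>x. \<Sum>i\<in>I. f i x) = (\<Sum>i\<in>I. walk_expectation n (f i))"
  by (simp add: walk_expectation_def)

text \<open>A discrete form of the Gaussian integration by parts E[X g(X)] = E[g'(X)]: by
  exchangeability each of the n + 1 steps contributes the same amount. The proof is an induction
  over all \<open>g\<close>, conditioning on the last step.\<close>

lemma walk_expectation_mult_self:
  fixes g :: "real \<Rightarrow> real"
  shows "walk_expectation (Suc n) (\<lambda>x. x * g x)
    = real (Suc n) / 2 * walk_expectation n (\<lambda>x. g (x + 1) - g (x - 1))"
proof (induction n arbitrary: g)
  case 0
  then show ?case by (simp add: walk_expectation_Suc)
next
  case (Suc n)
  let ?D = "\<lambda>x. g (x + 1) - g (x - 1)"
  have "walk_expectation (Suc (Suc n)) (\<lambda>x. x * g x)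
      = (walk_expectation (Suc n) (\<lambda>x. x * (g (x + 1) + g (x - 1)) + ?D x)) / 2"
    by (subst walk_expectation_Suc) (simp add: walk_expectation_add[symmetric] algebra_simps)
  also have "\<dots> = (walk_expectation (Suc n) (\<lambda>x. x * (g (x + 1) + g (x - 1))) + walk_expectation (Suc n) ?D) / 2"
    by (simp only: walk_expectation_add)
  \<comment> \<open>For h(x) = g(x + 1) + g(x - 1) the difference h(x + 1) - h(x - 1) equals
    \<open>?D\<close> at x + 1 plus \<open>?D\<close> at x - 1, which is again one step of the
    walk.\<close>
  also have "walk_expectation (Suc n) (\<lambda>x. x * (g (x + 1) + g (x - 1))) = real (Suc n) * walk_expectation (Suc n) ?D"
    by (subst Suc.IH, subst walk_expectation_Suc)
      (simp add: walk_expectation_add[symmetric] walk_expectation_diff[symmetric] algebra_simps)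
  finally show ?case by (simp add: algebra_simps)
qed

lemma walk_expectation_power_Suc:
  "walk_expectation (Suc n) (\<lambda>x. x ^ Suc r)
    = real (Suc n) * (\<Sum>i\<le>r. real (r choose i) * of_bool (odd i) * walk_expectation n (\<lambda>x. x ^ (r - i)))"
proof -
  have binom: "((x::real) + 1) ^ r - (x - 1) ^ r = (\<Sum>i\<le>r. (2 * (real (r choose i) * of_bool (odd i))) * x ^ (r - i))" for x
  proof -
    have "(1 + x) ^ r - (- 1 + x) ^ r = (\<Sum>i\<le>r. real (r choose i) * 1 ^ i * x ^ (r - i) - real (r choose i) * (- 1) ^ i * x ^ (r - i))"
      by (simp only: binomial_ring sum_subtractf)
    also have "\<dots> = (\<Sum>i\<le>r. (2 * (real (r choose i) * of_bool (odd i))) * x ^ (r - i))"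
      by (intro sum.cong) auto
    finally show ?thesis by (simp add: add.commute)
  qed
  have "walk_expectation (Suc n) (\<lambda>x. x ^ Suc r) = real (Suc n) / 2 * walk_expectation n (\<lambda>x. (x + 1) ^ r - (x - 1) ^ r)"
    using walk_expectation_mult_self[of n "\<lambda>x. x ^ r"] by simp
  also have "\<dots> = real (Suc n) * (\<Sum>i\<le>r. real (r choose i) * of_bool (odd i) * walk_expectation n (\<lambda>x. x ^ (r - i)))"
    unfolding binom walk_expectation_sum walk_expectation_cmult
    by (simp add: sum_distrib_left sum_divide_distrib mult.assoc)
  finally show ?thesis .
qed

text \<open>The Gaussian counterpart of the walk recursion. For \<open>r = 0\<close> the truncated
  \<open>r - 1\<close> is harmless because of the factor 0.\<close>

lemma std_normal_moment_Suc:
  "(LINT x|std_normal_distribution. x ^ Suc r) = real r * (LINT x|std_normal_distribution. x ^ (r - 1))"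
proof (cases "even r")
  case True
  then have "odd (Suc r)" "r = 0 \<or> odd (r - 1)" by auto
  then show ?thesis
    unfolding integral_std_normal_distribution_moment_odd[OF \<open>odd (Suc r)\<close>]
    by (auto simp: integral_std_normal_distribution_moment_odd)
next
  case False
  then obtain k where k: "r = 2 * k + 1" by (elim oddE)
  have "Suc r = 2 * Suc k" "r - 1 = 2 * k" by (simp_all add: k)
  then show ?thesis
    unfolding std_normal_distribution_even_moments \<open>Suc r = 2 * Suc k\<close> \<open>r - 1 = 2 * k\<close>
  proof -
    have "fact (2 * Suc k) = (2 * real k + 2) * ((2 * real k + 1) * fact (2 * k))"
      by (simp add: algebra_simps)
    moreover have "2 ^ Suc k * fact (Suc k) = (2 * real k + 2) * (2 ^ k * fact k)"
      by (simp add: algebra_simps)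
    moreover have "2 * real k + 2 \<noteq> 0" by linarith
    ultimately show "fact (2 * Suc k) / (2 ^ Suc k * fact (Suc k)) = real r * (fact (2 * k) / (2 ^ k * fact k) :: real)"
      by (simp only: mult_divide_mult_cancel_left) (simp add: k)
  qed
qed

text \<open>After normalisation the i-th term of the recursion carries an extra factor (n + 1)^(-(i
  - 1)/2). Only i = 1 survives in the limit, leaving the Gaussian recursion.\<close>

lemma walk_moment_tendsto:
  "(\<lambda>n. walk_expectation n (\<lambda>x. x ^ r) / sqrt (real n) ^ r) \<longlonglongrightarrow> (LINT x|std_normal_distribution. x ^ r)"
proof (induction r rule: less_induct)
  case (less r)
  define G where "G = (\<lambda>r. LINT x|std_normal_distribution. x ^ r)"
  define a where "a = (\<lambda>r n. walk_expectation n (\<lambda>x. x ^ r) / sqrt (real n) ^ r)"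
  show ?case
  proof (cases r)
    case 0
    have "(\<lambda>n. walk_expectation n (\<lambda>x. x ^ 0 :: real)) = (\<lambda>n. 1)"
      by (simp add: walk_expectation_def)
    then show ?thesis using std_normal_distribution_even_moments(1)[of 0] by (simp add: 0)
  next
    case (Suc q)
    have IH: "a k \<longlonglongrightarrow> G k" if "k \<le> q" for k
      using less.IH[of k] that by (simp add: Suc a_def G_def)
    define u where "u = (\<lambda>n. sqrt (real n) / sqrt (real (Suc n)))"
    define c where "c = (\<lambda>i. real (q choose i) * of_bool (odd i))"
    have u: "u \<longlonglongrightarrow> 1" unfolding u_def by real_asymp
    have v: "(\<lambda>n. 1 / sqrt (real (Suc n))) \<longlonglongrightarrow> 0" by real_asymp
    have eq: "a r (Suc n) = (\<Sum>i\<le>q. c i * a (q - i) n * u n ^ (q - i) * (1 / sqrt (real (Suc n))) ^ (i - 1))"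
      if n: "n > 0" for n
    proof -
      define w where "w = sqrt (real (Suc n))"
      have w: "w > 0" "real (Suc n) = w ^ 2" by (simp_all add: w_def)
      have "a r (Suc n) = (\<Sum>i\<le>q. c i * walk_expectation n (\<lambda>x. x ^ (q - i)) * (w ^ 2 / w ^ Suc q))"
        unfolding a_def Suc walk_expectation_power_Suc w_def[symmetric] unfolding w(2)
        by (simp add: sum_distrib_left sum_divide_distrib c_def mult_ac)
      also have "\<dots> = (\<Sum>i\<le>q. c i * a (q - i) n * u n ^ (q - i) * (1 / w) ^ (i - 1))"
      proof (intro sum.cong refl)
        fix i assume i: "i \<in> {..q}"
        show "c i * walk_expectation n (\<lambda>x. x ^ (q - i)) * (w ^ 2 / w ^ Suc q)
            = c i * a (q - i) n * u n ^ (q - i) * (1 / w) ^ (i - 1)"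
        proof (cases "i = 0")
          case False
          \<comment> \<open>The power \<open>q - i\<close> changes the normalisation from n to n +
            1, the 2 cancels the prefactor n + 1, and \<open>i - 1\<close> is the surplus that tends
            to 0. The case i = 0 needs no power, as \<open>c 0 = 0\<close>.\<close>
          then have "Suc q = (q - i) + (i - 1) + 2" using i by simp
          then have "w ^ Suc q = w ^ (q - i) * w ^ (i - 1) * w ^ 2" by (metis power_add)
          then show ?thesis using w n
            by (simp add: a_def u_def w_def[symmetric] power_divide)
        qed (simp add: c_def)
      qed
      finally show ?thesis by (simp add: w_def)
    qed
    have "(\<lambda>n. \<Sum>i\<le>q. c i * a (q - i) n * u n ^ (q - i) * (1 / sqrt (real (Suc n))) ^ (i - 1))
        \<longlonglongrightarrow> (\<Sum>i\<le>q. c i * G (q - i) * 1 ^ (q - i) * 0 ^ (i - 1))"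
      by (intro tendsto_intros IH u v) auto
    also have "(\<Sum>i\<le>q. c i * G (q - i) * 1 ^ (q - i) * 0 ^ (i - 1)) = (\<Sum>i\<le>q. if i = 1 then real q * G (q - 1) else 0)"
      by (intro sum.cong) (auto simp: c_def power_0_left le_Suc_eq)
    also have "\<dots> = G r" using std_normal_moment_Suc[of q] by (auto simp: G_def Suc)
    finally have "(\<lambda>n. a r (Suc n)) \<longlonglongrightarrow> G r"
      by (rule Lim_transform_eventually) (use eventually_gt_at_top[of 0] in \<open>eventually_elim, simp add: eq\<close>)
    then show ?thesis unfolding a_def G_def by (rule LIMSEQ_imp_Suc)
  qed
qed

section \<open>Characteristic function of the simple random walk\<close>

lemma walk_expectation_iexp: "walk_expectation n (\<lambda>x. iexp (t * x)) = complex_of_real (cos t ^ n)"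
proof (induction n)
  case (Suc n)
  have e: "iexp (t * (x + 1)) = iexp t * iexp (t * x)" "iexp (t * (x - 1)) = iexp (- t) * iexp (t * x)" for x
    by (simp_all add: exp_add[symmetric] algebra_simps)
  have "walk_expectation (Suc n) (\<lambda>x. iexp (t * x)) = (iexp t + iexp (- t)) / 2 * walk_expectation n (\<lambda>x. iexp (t * x))"
    unfolding walk_expectation_Suc e walk_expectation_cmult by (simp add: algebra_simps add_divide_distrib)
  also have "(iexp t + iexp (- t)) / 2 = complex_of_real (cos t)"
    by (simp add: complex_eq_iff Re_exp Im_exp)
  finally show ?case using Suc by simp
qed simp

lemma cos_power_tendsto: "(\<lambda>n. cos (t / (4 * sqrt (real n))) ^ n) \<longlonglongrightarrow> exp (- (t\<^sup>2 / 32))"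
  unfolding power2_eq_square by real_asymp

section \<open>Transfer of limits\<close>

lemma abs_power_diff_le:
  fixes a b M :: real
  assumes "\<bar>a\<bar> \<le> M" "\<bar>b\<bar> \<le> M" "1 \<le> M"
  shows "\<bar>a ^ r - b ^ r\<bar> \<le> real r * \<bar>a - b\<bar> * M ^ r"
proof (induction r)
  case (Suc r)
  have "\<bar>a ^ Suc r - b ^ Suc r\<bar> = \<bar>a * (a ^ r - b ^ r) + (a - b) * b ^ r\<bar>"
    by (simp add: algebra_simps)
  also have "\<dots> \<le> \<bar>a\<bar> * \<bar>a ^ r - b ^ r\<bar> + \<bar>a - b\<bar> * \<bar>b\<bar> ^ r"
    by (rule order_trans[OF abs_triangle_ineq]) (simp add: abs_mult power_abs)
  also have "\<dots> \<le> M * (real r * \<bar>a - b\<bar> * M ^ r) + \<bar>a - b\<bar> * M ^ Suc r"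
  proof (intro add_mono mult_mono Suc.IH mult_left_mono)
    have "\<bar>b\<bar> ^ r \<le> M ^ r" using assms by (intro power_mono) auto
    also have "\<dots> \<le> M ^ Suc r" using assms by (intro power_increasing) auto
    finally show "\<bar>b\<bar> ^ r \<le> M ^ Suc r" .
  qed (use assms in auto)
  finally show ?case by (simp add: algebra_simps)
qed simp

text \<open>Replaces absolute values by an even power, so that convergence of ordinary moments
  controls the right-hand side.\<close>

lemma power_abs_plus_one_le: "(\<bar>b\<bar> + 1) ^ r \<le> 2 ^ r * (2 + b ^ (2 * r))" for b :: real
proof -
  have "(\<bar>b\<bar> + 1) ^ r \<le> (2 * max 1 \<bar>b\<bar>) ^ r" by (intro power_mono) auto
  also have "\<dots> = 2 ^ r * max 1 \<bar>b\<bar> ^ r" by (rule power_mult_distrib)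
  also have "max 1 \<bar>b\<bar> ^ r \<le> 2 + b ^ (2 * r)"
  proof (cases "\<bar>b\<bar> \<le> 1")
    case True
    then show ?thesis by (simp add: power_mult max_def)
  next
    case False
    then have "\<bar>b\<bar> ^ r \<le> \<bar>b\<bar> ^ (2 * r)" by (intro power_increasing) auto
    then show ?thesis using False by (simp add: power_even_abs max_def)
  qed
  finally show ?thesis by simp
qed

lemma cmod_iexp_diff_le: "cmod (iexp a - iexp b) \<le> \<bar>a - b\<bar>"
proof -
  have "iexp a - iexp b = iexp b * (iexp (a - b) - 1)"
    by (simp add: exp_add[symmetric] algebra_simps)
  then have "cmod (iexp a - iexp b) = cmod (iexp (a - b) - 1)"
    by (simp add: norm_mult)
  also have "\<dots> \<le> \<bar>a - b\<bar>" using iexp_approx1[of "a - b" 0] by simp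
  finally show ?thesis .
qed

lemma expectation_le_const_plus_tail:
  fixes f g :: "'a \<Rightarrow> real"
  assumes fin: "finite (set_pmf p)" and c: "0 \<le> c"
    and g: "\<And>x. x \<in> set_pmf p \<Longrightarrow> 0 \<le> g x"
    and good: "\<And>x. x \<in> set_pmf p \<Longrightarrow> x \<notin> S \<Longrightarrow> f x \<le> g x"
    and bad: "\<And>x. x \<in> set_pmf p \<Longrightarrow> f x \<le> c"
  shows "measure_pmf.expectation p f \<le> measure_pmf.expectation p g + c * measure p S"
proof -
  note int = integrable_measure_pmf_finite[OF fin]
  have "measure_pmf.expectation p f \<le> measure_pmf.expectation p (\<lambda>x. g x + c * indicator S x)"
  proof (intro integral_mono_AE int)
    show "AE x in p. f x \<le> g x + c * indicator S x"
      using g good bad by (auto simp: AE_measure_pmf_iff indicator_def intro: add_increasing)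
  qed
  also have "\<dots> = measure_pmf.expectation p g + c * measure p S"
    by (simp add: int)
  finally show ?thesis .
qed

text \<open>The pathwise bound \<open>n\<close> is crude, so moments of order r transfer only if the
  exceptional probability is o(n^(-r)); this is why closeness is required with every polynomial
  weight.\<close>

locale close_sequences =
  fixes P :: "nat \<Rightarrow> 'a pmf" and A B :: "nat \<Rightarrow> 'a \<Rightarrow> real"
  assumes fin: "\<And>n. finite (set_pmf (P n))"
    and A_bound: "\<And>n x. n \<ge> 1 \<Longrightarrow> x \<in> set_pmf (P n) \<Longrightarrow> \<bar>A n x\<bar> \<le> real n"
    and B_bound: "\<And>n x. n \<ge> 1 \<Longrightarrow> x \<in> set_pmf (P n) \<Longrightarrow> \<bar>B n x\<bar> \<le> real n"
    and close: "\<And>\<epsilon> r. \<epsilon> > 0 \<Longrightarrow>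
      (\<lambda>n. real n ^ r * measure (P n) {x. \<bar>A n x - B n x\<bar> > \<epsilon>}) \<longlonglongrightarrow> 0"
begin

text \<open>Off the exceptional event the r-th powers differ by at most \<epsilon> times an
  expression whose mean converges, by the assumed moment of order 2r; on it they differ by at most 2
  n^r.\<close>

lemma expectation_power_tendsto:
  assumes mom: "\<And>r. (\<lambda>n. measure_pmf.expectation (P n) (\<lambda>x. B n x ^ r)) \<longlonglongrightarrow> G r"
  shows "(\<lambda>n. measure_pmf.expectation (P n) (\<lambda>x. A n x ^ r)) \<longlonglongrightarrow> G r"
proof -
  note int = integrable_measure_pmf_finite[OF fin]
  define E where "E = (\<lambda>n. measure_pmf.expectation (P n) (\<lambda>x. \<bar>A n x ^ r - B n x ^ r\<bar>))"
  define c where "c = (\<lambda>n. real r * 2 ^ r * (2 + measure_pmf.expectation (P n) (\<lambda>x. B n x ^ (2 * r))))"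
  define C where "C = real r * 2 ^ r * (2 + G (2 * r))"
  have c: "c \<longlonglongrightarrow> C" unfolding c_def C_def by (intro tendsto_intros mom)
  have c0: "c n \<ge> 0" for n unfolding c_def
    by (intro mult_nonneg_nonneg add_nonneg_nonneg Bochner_Integration.integral_nonneg) auto
  have C0: "C \<ge> 0" using c c0 by (intro LIMSEQ_le_const) auto
  have E_le: "E n \<le> \<epsilon> * c n + 2 * (real n ^ r * measure (P n) {x. \<bar>A n x - B n x\<bar> > \<epsilon>})"
    if n: "n \<ge> 1" and \<epsilon>: "0 < \<epsilon>" "\<epsilon> \<le> 1" for n \<epsilon>
  proof -
    have "E n \<le> measure_pmf.expectation (P n) (\<lambda>x. real r * \<epsilon> * (2 ^ r * (2 + B n x ^ (2 * r))))
        + 2 * real n ^ r * measure (P n) {x. \<bar>A n x - B n x\<bar> > \<epsilon>}"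
      unfolding E_def
    proof (rule expectation_le_const_plus_tail[OF fin])
      fix x assume x: "x \<in> set_pmf (P n)"
      show "0 \<le> real r * \<epsilon> * (2 ^ r * (2 + B n x ^ (2 * r)))"
        using \<epsilon> by (simp add: zero_le_even_power)
      show "\<bar>A n x ^ r - B n x ^ r\<bar> \<le> 2 * real n ^ r"
      proof -
        have "\<bar>A n x ^ r - B n x ^ r\<bar> \<le> \<bar>A n x\<bar> ^ r + \<bar>B n x\<bar> ^ r"
          by (rule order_trans[OF abs_triangle_ineq4]) (simp add: power_abs)
        also have "\<dots> \<le> real n ^ r + real n ^ r"
          using A_bound[OF n x] B_bound[OF n x] by (intro add_mono power_mono) auto
        finally show ?thesis by simp
      qed
      assume "x \<notin> {x. \<bar>A n x - B n x\<bar> > \<epsilon>}"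
      then have d: "\<bar>A n x - B n x\<bar> \<le> \<epsilon>" by simp
      \<comment> \<open>As \<epsilon> <= 1, \<open>\<bar>B n x\<bar> + 1\<close> bounds both
        values.\<close>
      have "\<bar>A n x ^ r - B n x ^ r\<bar> \<le> real r * \<bar>A n x - B n x\<bar> * (\<bar>B n x\<bar> + 1) ^ r"
        using d \<epsilon> by (intro abs_power_diff_le) auto
      also have "\<dots> \<le> real r * \<epsilon> * (2 ^ r * (2 + B n x ^ (2 * r)))"
        using d by (intro mult_mono mult_left_mono power_abs_plus_one_le) (use \<epsilon> in auto)
      finally show "\<bar>A n x ^ r - B n x ^ r\<bar> \<le> real r * \<epsilon> * (2 ^ r * (2 + B n x ^ (2 * r)))" .
    qed auto
    also have "measure_pmf.expectation (P n) (\<lambda>x. real r * \<epsilon> * (2 ^ r * (2 + B n x ^ (2 * r)))) = \<epsilon> * c n"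
      by (simp add: c_def int)
    finally show ?thesis by (simp add: mult.assoc)
  qed
  have E0: "E \<longlonglongrightarrow> 0"
  proof (rule tendstoI)
    fix \<delta> :: real assume \<delta>: "\<delta> > 0"
    \<comment> \<open>Chosen so that \<epsilon> \<open>c n\<close> is at most \<delta>/2 once
      \<open>c n < C + 1\<close>; the exceptional event contributes less than the other
      half.\<close>
    define \<epsilon> where "\<epsilon> = min 1 (\<delta> / (2 * (C + 1)))"
    have \<epsilon>: "0 < \<epsilon>" "\<epsilon> \<le> 1" using \<delta> C0 by (auto simp: \<epsilon>_def)
    have 1: "eventually (\<lambda>n. c n < C + 1) sequentially"
      using order_tendstoD(2)[OF c, of "C + 1"] by simp
    have 2: "eventually (\<lambda>n. real n ^ r * measure (P n) {x. \<bar>A n x - B n x\<bar> > \<epsilon>} < \<delta> / 4) sequentially"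
      using order_tendstoD(2)[OF close[OF \<epsilon>(1), of r], of "\<delta> / 4"] \<delta> by simp
    show "eventually (\<lambda>n. dist (E n) 0 < \<delta>) sequentially"
      using 1 2 eventually_ge_at_top[of 1]
    proof eventually_elim
      case (elim n)
      have "\<epsilon> * c n \<le> \<epsilon> * (C + 1)" using elim \<epsilon> by (intro mult_left_mono) auto
      also have "\<dots> \<le> \<delta> / (2 * (C + 1)) * (C + 1)" using C0 by (intro mult_right_mono) (auto simp: \<epsilon>_def)
      also have "\<dots> = \<delta> / 2" using C0 by (simp add: field_simps)
      finally have "E n < \<delta>" using E_le[OF _ \<epsilon>, of n] elim by simp
      moreover have "E n \<ge> 0" unfolding E_def by (intro Bochner_Integration.integral_nonneg) auto
      ultimately show ?case by simp
    qed
  qed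
  have bnd: "norm (measure_pmf.expectation (P n) (\<lambda>x. A n x ^ r) - measure_pmf.expectation (P n) (\<lambda>x. B n x ^ r)) \<le> E n" for n
    unfolding E_def by (subst Bochner_Integration.integral_diff[symmetric]) (auto intro: int integral_abs_bound simp del: Bochner_Integration.integral_diff)
  have "(\<lambda>n. measure_pmf.expectation (P n) (\<lambda>x. A n x ^ r) - measure_pmf.expectation (P n) (\<lambda>x. B n x ^ r)) \<longlonglongrightarrow> 0"
    by (rule Lim_null_comparison[OF always_eventually E0]) (intro allI bnd)
  from tendsto_add[OF this mom[of r]] show ?thesis by simp
qed

text \<open>The same splitting, with the Lipschitz bound for the exponential off the exceptional
  event and the bound 2 on it.\<close>

lemma expectation_iexp_tendsto:
  assumes lim: "(\<lambda>n. measure_pmf.expectation (P n) (\<lambda>x. iexp (t * B n x))) \<longlonglongrightarrow> z"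
  shows "(\<lambda>n. measure_pmf.expectation (P n) (\<lambda>x. iexp (t * A n x))) \<longlonglongrightarrow> z"
proof -
  note int = integrable_measure_pmf_finite[OF fin]
  define E where "E = (\<lambda>n. measure_pmf.expectation (P n) (\<lambda>x. cmod (iexp (t * A n x) - iexp (t * B n x))))"
  have E_le: "E n \<le> \<bar>t\<bar> * \<epsilon> + 2 * measure (P n) {x. \<bar>A n x - B n x\<bar> > \<epsilon>}" if "\<epsilon> > 0" for n \<epsilon>
  proof -
    have "E n \<le> measure_pmf.expectation (P n) (\<lambda>x. \<bar>t\<bar> * \<epsilon>) + 2 * measure (P n) {x. \<bar>A n x - B n x\<bar> > \<epsilon>}"
      unfolding E_def
    proof (rule expectation_le_const_plus_tail[OF fin])
      fix x
      show "cmod (iexp (t * A n x) - iexp (t * B n x)) \<le> 2"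
        by (rule order_trans[OF norm_triangle_ineq4]) simp
      assume "x \<notin> {x. \<bar>A n x - B n x\<bar> > \<epsilon>}"
      then have "\<bar>t\<bar> * \<bar>A n x - B n x\<bar> \<le> \<bar>t\<bar> * \<epsilon>" by (intro mult_left_mono) auto
      then show "cmod (iexp (t * A n x) - iexp (t * B n x)) \<le> \<bar>t\<bar> * \<epsilon>"
        using cmod_iexp_diff_le[of "t * A n x" "t * B n x"]
        by (simp add: abs_mult[symmetric] right_diff_distrib)
    qed (use that in auto)
    then show ?thesis by simp
  qed
  have E0: "E \<longlonglongrightarrow> 0"
  proof (rule tendstoI)
    fix \<delta> :: real assume \<delta>: "\<delta> > 0"
    define \<epsilon> where "\<epsilon> = \<delta> / (2 * (\<bar>t\<bar> + 1))"
    have \<epsilon>: "0 < \<epsilon>" using \<delta> by (auto simp: \<epsilon>_def)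
    have "\<bar>t\<bar> * \<epsilon> \<le> (\<bar>t\<bar> + 1) * \<epsilon>" using \<epsilon> by (intro mult_right_mono) auto
    also have "\<dots> = \<delta> / 2" by (simp add: \<epsilon>_def field_simps)
    finally have t: "\<bar>t\<bar> * \<epsilon> \<le> \<delta> / 2" .
    have "eventually (\<lambda>n. real n ^ 0 * measure (P n) {x. \<bar>A n x - B n x\<bar> > \<epsilon>} < \<delta> / 4) sequentially"
      using order_tendstoD(2)[OF close[OF \<epsilon>, of 0], of "\<delta> / 4"] \<delta> by simp
    then show "eventually (\<lambda>n. dist (E n) 0 < \<delta>) sequentially"
    proof eventually_elim
      case (elim n)
      then have "E n < \<delta>" using E_le[OF \<epsilon>, of n] t by simp
      moreover have "E n \<ge> 0" unfolding E_def by (intro Bochner_Integration.integral_nonneg) auto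
      ultimately show ?case by simp
    qed
  qed
  have bnd: "cmod (measure_pmf.expectation (P n) (\<lambda>x. iexp (t * A n x)) - measure_pmf.expectation (P n) (\<lambda>x. iexp (t * B n x))) \<le> E n" for n
    unfolding E_def by (subst Bochner_Integration.integral_diff[symmetric]) (auto intro: int integral_norm_bound simp del: Bochner_Integration.integral_diff)
  have "(\<lambda>n. measure_pmf.expectation (P n) (\<lambda>x. iexp (t * A n x)) - measure_pmf.expectation (P n) (\<lambda>x. iexp (t * B n x))) \<longlonglongrightarrow> 0"
    by (rule Lim_null_comparison[OF always_eventually E0]) (intro allI bnd)
  from tendsto_add[OF this lim] show ?thesis by simp
qed

end

section \<open>The limit law as a standard normal variable divided by 4\<close>

lemma normal_law_eq_distr: "normal_law 0 (1 / 16) = distr std_normal_distribution borel (\<lambda>x. x / 4)"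
proof -
  interpret prob_space std_normal_distribution by (rule prob_space_normal_density) simp
  have "distributed std_normal_distribution lborel (\<lambda>x. x) (normal_density 0 1)"
    by (simp add: distributed_def distr_id2)
  from normal_density_affine[OF this, of "1 / 4" 0]
  have "distributed std_normal_distribution lborel (\<lambda>x. x / 4) (normal_density 0 (1 / 4))" by simp
  then have "distr std_normal_distribution lborel (\<lambda>x. x / 4) = density lborel (normal_density 0 (1 / 4))"
    by (rule distributed_distr_eq_density)
  moreover have "distr std_normal_distribution lborel (\<lambda>x. x / 4) = distr std_normal_distribution borel (\<lambda>x. x / 4)"
    by (rule distr_cong) auto
  moreover have "sqrt (1 / 16) = 1 / 4" by (rule real_sqrt_unique) (auto simp: power2_eq_square)
  ultimately show ?thesis by (simp only: normal_law_def)
qed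

lemma real_distribution_normal_law: "real_distribution (normal_law 0 (1 / 16))"
proof -
  interpret prob_space std_normal_distribution by (rule prob_space_normal_density) simp
  show ?thesis unfolding normal_law_eq_distr by (rule real_distribution_distr) simp
qed

lemma normal_law_moment: "(LINT x|normal_law 0 (1 / 16). x ^ r) = (LINT x|std_normal_distribution. x ^ r) / 4 ^ r"
  unfolding normal_law_eq_distr by (subst integral_distr) (auto simp: power_divide)

lemma char_normal_law: "char (normal_law 0 (1 / 16)) t = complex_of_real (exp (- (t\<^sup>2 / 32)))"
proof -
  have "char (normal_law 0 (1 / 16)) t = char std_normal_distribution (t / 4)"
    unfolding normal_law_eq_distr char_def by (subst integral_distr) auto
  then show ?thesis by (simp add: char_std_normal_distribution power_divide)
qed

section \<open>The maximum number of runs\<close>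

text \<open>The leading exponents are -2 n^(1/5) in the first summand and -\<epsilon> n^(1/10) in
  the second, where the bracket adds only 9 n t^3 = 9 n^(-1/5). Both beat every power of n.\<close>

lemma superpolynomial_tail_bound:
  fixes \<epsilon> :: real
  assumes "\<epsilon> > 0"
  defines "t \<equiv> \<lambda>n. real n powr (-2 / 5)"
  shows "(\<lambda>n. real n ^ r * (2 * exp (- 2 * (real n powr (3 / 5))\<^sup>2 / real n)
    + real (Suc n) * ((exp 1 * real (Suc n)) ^ 4 * exp (t n * (3 - (\<epsilon> * sqrt (real n) - 1))
        + real n * (t n * (t n)\<^sup>2 + 4 * (t n)\<^sup>2 * t n + 4 * t n ^ 3))))) \<longlonglongrightarrow> 0"
  using assms(1) unfolding t_def by real_asymp

lemma normalizer_eq: "real n powr (-1 / 2) = 1 / sqrt (real n)"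
  by (simp add: powr_minus powr_half_sqrt inverse_eq_divide)

text \<open>Half the number of changes is left unrounded, so that this is exactly an affine function
  of a binomial variable; the rounding is charged to the comparison with the maximum.\<close>

definition normalized_changes :: "nat \<Rightarrow> nat \<times> (nat \<Rightarrow> nat) \<Rightarrow> real" where
  "normalized_changes n \<omega> = (real (change_count n \<omega>) / 2 - real n / 4) / sqrt (real n)"

lemma num_runs_eq_change_count:
  assumes "n \<ge> 1"
  shows "num_runs n \<sigma> m = (change_count n (m, \<sigma>) + 1) div 2"
  using assms by (simp add: num_runs_eq_runs runs_eq_changes change_count_def)

lemma max_runs_ge: "m \<le> n \<Longrightarrow> num_runs n \<sigma> m \<le> max_runs n \<sigma>"
  unfolding max_runs_def by (intro Max_ge) auto

lemma max_runs_attained: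
  obtains k where "k \<le> n" "max_runs n \<sigma> = num_runs n \<sigma> k"
proof -
  have "max_runs n \<sigma> \<in> num_runs n \<sigma> ` {0..n}" unfolding max_runs_def by (intro Max_in) auto
  then show ?thesis using that by auto
qed

lemma max_runs_le:
  assumes "n \<ge> 1" shows "max_runs n \<sigma> \<le> n"
proof -
  obtain k where "max_runs n \<sigma> = num_runs n \<sigma> k" by (rule max_runs_attained)
  then show ?thesis
    using runs_le_length[of False "bit_string n k \<sigma>"]
    by (simp add: num_runs_eq_runs[OF assms] bit_string_def)
qed

text \<open>Conditions on the random time m. The first summand is the probability that m leaves the
  window around n/2; for m inside it, the second sums the two-time bound over all n + 1
  competitors.\<close>

lemma prob_normalized_max_runs_far_le:
  assumes n: "n \<ge> 1" and \<epsilon>: "\<epsilon> > 0" and t: "t = real n powr (-2 / 5)" "t \<le> 1 / 2"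
  shows "measure (pair_pmf (binomial_pmf n (1 / 2)) (uniform_perm n))
      {\<omega>. \<bar>normalized_max_runs n (snd \<omega>) - normalized_changes n \<omega>\<bar> > \<epsilon>}
    \<le> 2 * exp (- 2 * (real n powr (3 / 5))\<^sup>2 / real n)
      + real (Suc n) * ((exp 1 * real (Suc n)) ^ 4 * exp (t * (3 - (\<epsilon> * sqrt (real n) - 1))
          + real n * (t * t\<^sup>2 + 4 * t\<^sup>2 * t + 4 * t ^ 3)))"
proof -
  define S where "S = {\<omega>. \<bar>normalized_max_runs n (snd \<omega>) - normalized_changes n \<omega>\<bar> > \<epsilon>}"
  \<comment> \<open>The 1 subtracted pays for rounding half the number of changes up.\<close>
  define s where "s = \<epsilon> * sqrt (real n) - 1"
  define Q where "Q = (exp 1 * real (Suc n)) ^ 4 * exp (t * (3 - s) + real n * (t * t\<^sup>2 + 4 * t\<^sup>2 * t + 4 * t ^ 3))"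
  define U where "U = (\<lambda>m k. {\<sigma>. real (runs False (bit_string n k \<sigma>)) - real (runs False (bit_string n m \<sigma>)) \<ge> s})"
  have Q0: "Q \<ge> 0" by (simp add: Q_def)
  have t0: "0 \<le> t" by (simp add: t)
  have sub: "Pair m -` S \<subseteq> (\<Union>k\<in>{..n}. U m k)" if m: "m \<le> n" for m
  proof
    fix \<sigma> assume "\<sigma> \<in> Pair m -` S"
    then have *: "\<epsilon> < \<bar>normalized_max_runs n \<sigma> - normalized_changes n (m, \<sigma>)\<bar>" by (simp add: S_def)
    define c where "c = change_count n (m, \<sigma>)"
    have "real (max_runs n \<sigma>) \<ge> real ((c + 1) div 2)"
      using max_runs_ge[OF m, of \<sigma>] by (simp add: num_runs_eq_change_count[OF n] c_def)
    moreover have "real c / 2 \<le> real ((c + 1) div 2)" by linarith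
    ultimately have ge: "real (max_runs n \<sigma>) - real c / 2 \<ge> 0" by simp
    have "normalized_max_runs n \<sigma> - normalized_changes n (m, \<sigma>) = (real (max_runs n \<sigma>) - real c / 2) / sqrt (real n)"
      unfolding normalized_max_runs_def normalizer_eq
      by (simp add: normalized_changes_def c_def diff_divide_distrib)
    then have "\<epsilon> < (real (max_runs n \<sigma>) - real c / 2) / sqrt (real n)"
      using * ge by simp
    then have lt: "\<epsilon> * sqrt (real n) < real (max_runs n \<sigma>) - real c / 2"
      using n by (simp add: pos_less_divide_eq)
    \<comment> \<open>The maximising time varies with \<sigma>, which is why the conclusion is a
      union over all \<open>k\<close>.\<close>
    obtain k where k: "k \<le> n" "max_runs n \<sigma> = num_runs n \<sigma> k" by (rule max_runs_attained)
    have "real ((c + 1) div 2) \<le> real c / 2 + 1" by linarith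
    then have "real (num_runs n \<sigma> m) \<le> real c / 2 + 1"
      by (simp add: num_runs_eq_change_count[OF n] c_def)
    then have "s \<le> real (num_runs n \<sigma> k) - real (num_runs n \<sigma> m)"
      using lt k by (simp add: s_def)
    then show "\<sigma> \<in> (\<Union>k\<in>{..n}. U m k)"
      using k(1) by (auto simp: U_def num_runs_eq_runs[OF n])
  qed
  have good: "measure (uniform_perm n) (Pair m -` S) \<le> real (Suc n) * Q"
    if m: "m \<le> n" "\<not> \<bar>real m - real n * (1 / 2)\<bar> \<ge> real n powr (3 / 5)" for m
  proof -
    \<comment> \<open>The half-width n^(3/5) divided by n is exactly \<open>t\<close>, so one
      parameter serves as window size and as Chernoff parameter.\<close>
    have "real m / real n - 1 / 2 = (real m - real n * (1 / 2)) / real n"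
      using n by (simp add: field_simps)
    then have "\<bar>real m / real n - 1 / 2\<bar> = \<bar>real m - real n * (1 / 2)\<bar> / real n"
      using n by (simp only: abs_divide abs_of_nat)
    also have "\<dots> \<le> real n powr (3 / 5) / real n powr 1"
      using m n by (intro frac_le) auto
    also have "\<dots> = t" by (simp only: powr_diff[symmetric] t) simp
    finally have e: "\<bar>real m / real n - 1 / 2\<bar> \<le> t" .
    have "measure (uniform_perm n) (Pair m -` S) \<le> measure (uniform_perm n) (\<Union>k\<in>{..n}. U m k)"
      using sub[OF m(1)] by (intro measure_pmf.finite_measure_mono) auto
    also have "\<dots> \<le> (\<Sum>k\<in>{..n}. measure (uniform_perm n) (U m k))"
      by (intro measure_pmf.finite_measure_subadditive_finite) auto
    also have "\<dots> \<le> (\<Sum>k\<in>{..n}. Q)"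
      unfolding U_def Q_def by (intro sum_mono prob_runs_difference_ge[OF n _ m(1) t0 t(2) e]) auto
    finally show ?thesis by simp
  qed
  have fin: "finite (set_pmf (binomial_pmf n (1 / 2)))" by auto
  have finP: "finite (set_pmf (uniform_perm n))" by (simp only: set_uniform_perm finite_permutations_interval)
  have pair: "pair_pmf (binomial_pmf n (1 / 2)) (uniform_perm n)
      = binomial_pmf n (1 / 2) \<bind> (\<lambda>m. map_pmf (Pair m) (uniform_perm n))"
    by (simp add: pair_pmf_def map_pmf_def)
  have "measure (pair_pmf (binomial_pmf n (1 / 2)) (uniform_perm n)) S
      = measure_pmf.expectation (binomial_pmf n (1 / 2) \<bind> (\<lambda>m. map_pmf (Pair m) (uniform_perm n))) (indicator S)"
    unfolding pair by simp
  also have "\<dots> = measure_pmf.expectation (binomial_pmf n (1 / 2)) (\<lambda>m. measure (uniform_perm n) (Pair m -` S))"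
    using finP by (subst expectation_bind_pmf_finite[OF fin]) simp_all
  also have "\<dots> \<le> measure_pmf.expectation (binomial_pmf n (1 / 2)) (\<lambda>m. real (Suc n) * Q)
      + 1 * measure (binomial_pmf n (1 / 2)) {m. \<bar>real m - real n * (1 / 2)\<bar> \<ge> real n powr (3 / 5)}"
    using good Q0 by (intro expectation_le_const_plus_tail[OF fin]) auto
  \<comment> \<open>Hoeffding's inequality for the random time.\<close>
  also have "measure (binomial_pmf n (1 / 2)) {m. \<bar>real m - real n * (1 / 2)\<bar> \<ge> real n powr (3 / 5)}
      \<le> 2 * exp (- 2 * (real n powr (3 / 5))\<^sup>2 / real n)"
  proof -
    interpret binomial_distribution n "1 / 2" by unfold_locales auto
    show ?thesis using n by (intro prob_abs_ge) auto
  qed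
  finally show ?thesis by (simp add: S_def Q_def s_def)
qed

interpretation runs: close_sequences "\<lambda>n. pair_pmf (binomial_pmf n (1 / 2)) (uniform_perm n)"
  "\<lambda>n \<omega>. normalized_max_runs n (snd \<omega>)" normalized_changes
proof
  fix n :: nat
  show "finite (set_pmf (pair_pmf (binomial_pmf n (1 / 2)) (uniform_perm n)))"
    by (simp add: set_uniform_perm finite_permutations_interval del: One_nat_def)
next
  have *: "\<bar>(x - real n / 4) / sqrt (real n)\<bar> \<le> real n" if "n \<ge> 1" "0 \<le> x" "x \<le> real n" for n x
  proof -
    have "\<bar>(x - real n / 4) / sqrt (real n)\<bar> = \<bar>x - real n / 4\<bar> / sqrt (real n)" by simp
    also have "\<dots> \<le> real n / 1" using that by (intro frac_le) auto
    finally show ?thesis by simp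
  qed
  fix n :: nat and \<omega> :: "nat \<times> (nat \<Rightarrow> nat)" assume n: "n \<ge> 1"
  show "\<bar>normalized_max_runs n (snd \<omega>)\<bar> \<le> real n"
    using *[OF n, of "real (max_runs n (snd \<omega>))"] max_runs_le[OF n]
    unfolding normalized_max_runs_def normalizer_eq by simp
  have "change_count n \<omega> \<le> n"
    unfolding change_count_def bit_string_def split_beta
    by (rule order_trans[OF changes_le_length]) simp
  then show "\<bar>normalized_changes n \<omega>\<bar> \<le> real n"
    using *[OF n, of "real (change_count n \<omega>) / 2"] by (simp add: normalized_changes_def)
next
  fix \<epsilon> :: real and r :: nat assume \<epsilon>: "\<epsilon> > 0"
  have "(\<lambda>n. real n powr (-2 / 5)) \<longlonglongrightarrow> 0" by real_asymp
  then have "eventually (\<lambda>n. real n powr (-2 / 5) < 1 / 2) sequentially"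
    by (rule order_tendstoD) simp
  then have "eventually (\<lambda>n. norm (real n ^ r * measure (pair_pmf (binomial_pmf n (1 / 2)) (uniform_perm n))
      {\<omega>. \<bar>normalized_max_runs n (snd \<omega>) - normalized_changes n \<omega>\<bar> > \<epsilon>})
    \<le> real n ^ r * (2 * exp (- 2 * (real n powr (3 / 5))\<^sup>2 / real n)
      + real (Suc n) * ((exp 1 * real (Suc n)) ^ 4 * exp (real n powr (-2 / 5) * (3 - (\<epsilon> * sqrt (real n) - 1))
          + real n * (real n powr (-2 / 5) * (real n powr (-2 / 5))\<^sup>2
            + 4 * (real n powr (-2 / 5))\<^sup>2 * real n powr (-2 / 5) + 4 * (real n powr (-2 / 5)) ^ 3))))) sequentially"
    using eventually_ge_at_top[of 1]
  proof eventually_elim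
    case (elim n)
    show ?case
      using prob_normalized_max_runs_far_le[OF _ \<epsilon> refl, of n] elim
      by (subst real_norm_def, subst abs_of_nonneg) (auto intro!: mult_left_mono)
  qed
  then show "(\<lambda>n. real n ^ r * measure (pair_pmf (binomial_pmf n (1 / 2)) (uniform_perm n))
      {\<omega>. \<bar>normalized_max_runs n (snd \<omega>) - normalized_changes n \<omega>\<bar> > \<epsilon>}) \<longlonglongrightarrow> 0"
    by (rule Lim_null_comparison[OF _ superpolynomial_tail_bound[OF \<epsilon>]])
qed

text \<open>With C changes, (C/2 - n/4)/sqrt n = (2C - n)/(4 sqrt n), a rescaled walk
  position.\<close>

lemma expectation_normalized_changes:
  "measure_pmf.expectation (pair_pmf (binomial_pmf n (1 / 2)) (uniform_perm n)) (\<lambda>\<omega>. h (normalized_changes n \<omega>))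
    = walk_expectation n (\<lambda>x. h (x / (4 * sqrt (real n))))"
proof -
  let ?P = "pair_pmf (binomial_pmf n (1 / 2)) (uniform_perm n)"
  have "walk_expectation n (\<lambda>x. h (x / (4 * sqrt (real n))))
      = measure_pmf.expectation (map_pmf (change_count n) ?P) (\<lambda>s. h ((2 * real s - real n) / (4 * sqrt (real n))))"
    unfolding map_pmf_change_count walk_expectation_def ..
  also have "\<dots> = measure_pmf.expectation ?P (\<lambda>\<omega>. h (normalized_changes n \<omega>))"
  proof -
    have "(2 * real c - real n) / (4 * sqrt (real n)) = (real c / 2 - real n / 4) / sqrt (real n)" for c
      by (simp add: field_simps)
    then show ?thesis by (simp add: normalized_changes_def)
  qed
  finally show ?thesis ..
qed

lemma normalized_changes_moment_tendsto:
  "(\<lambda>n. measure_pmf.expectation (pair_pmf (binomial_pmf n (1 / 2)) (uniform_perm n)) (\<lambda>\<omega>. normalized_changes n \<omega> ^ r))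
    \<longlonglongrightarrow> (LINT x|normal_law 0 (1 / 16). x ^ r)"
proof -
  have "walk_expectation n (\<lambda>x. (x / (4 * sqrt (real n))) ^ r) = walk_expectation n (\<lambda>x. x ^ r) / sqrt (real n) ^ r / 4 ^ r" for n
    by (simp add: walk_expectation_def power_divide power_mult_distrib)
  then show ?thesis
    using tendsto_divide[OF walk_moment_tendsto[of r] tendsto_const, of "4 ^ r"]
    by (simp add: expectation_normalized_changes[where h = "\<lambda>x. x ^ r"] normal_law_moment)
qed

lemma normalized_changes_iexp_tendsto:
  "(\<lambda>n. measure_pmf.expectation (pair_pmf (binomial_pmf n (1 / 2)) (uniform_perm n)) (\<lambda>\<omega>. iexp (t * normalized_changes n \<omega>)))
    \<longlonglongrightarrow> char (normal_law 0 (1 / 16)) t"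
proof -
  have "walk_expectation n (\<lambda>x. iexp (t * (x / (4 * sqrt (real n)))))
      = complex_of_real (cos (t / (4 * sqrt (real n))) ^ n)" for n
    using walk_expectation_iexp[of n "t / (4 * sqrt (real n))"] by simp
  then show ?thesis
    unfolding expectation_normalized_changes[where h = "\<lambda>x. iexp (t * x)"] char_normal_law
    by (simp only: tendsto_of_real_iff cos_power_tendsto)
qed

text \<open>The maximum does not involve the auxiliary time, so the product space projects to the
  permutation alone.\<close>

lemma normalized_max_runs_moment_tendsto:
  "(\<lambda>n. measure_pmf.expectation (uniform_perm n) (\<lambda>\<sigma>. normalized_max_runs n \<sigma> ^ r))
    \<longlonglongrightarrow> (LINT x|normal_law 0 (1 / 16). x ^ r)"
  using runs.expectation_power_tendsto[OF normalized_changes_moment_tendsto, of r]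
  unfolding expectation_pair_pmf_snd[of _ _ "\<lambda>\<sigma>. normalized_max_runs _ \<sigma> ^ r"] .

text \<open>By Levy's continuity theorem, from the transferred characteristic functions.\<close>

lemma normalized_max_runs_weak_conv:
  "weak_conv_m (\<lambda>n. distr (measure_pmf (uniform_perm n)) borel (normalized_max_runs n)) (normal_law 0 (1 / 16))"
proof (rule levy_continuity[OF _ real_distribution_normal_law])
  fix n show "real_distribution (distr (measure_pmf (uniform_perm n)) borel (normalized_max_runs n))"
    by (rule prob_space.real_distribution_distr[OF measure_pmf.prob_space_axioms]) simp
next
  fix t
  have "char (distr (measure_pmf (uniform_perm n)) borel (normalized_max_runs n)) t
      = measure_pmf.expectation (uniform_perm n) (\<lambda>\<sigma>. iexp (t * normalized_max_runs n \<sigma>))" for n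
    unfolding char_def by (subst integral_distr) auto
  then show "(\<lambda>n. char (distr (measure_pmf (uniform_perm n)) borel (normalized_max_runs n)) t)
      \<longlonglongrightarrow> char (normal_law 0 (1 / 16)) t"
    using runs.expectation_iexp_tendsto[OF normalized_changes_iexp_tendsto, of t]
    unfolding expectation_pair_pmf_snd[of _ _ "\<lambda>\<sigma>. iexp (t * normalized_max_runs _ \<sigma>)"] by simp
qed

section \<open>Mean and variance from the first two normalised moments\<close>

lemma integrable_uniform_perm:
  fixes f :: "_ \<Rightarrow> real" shows "integrable (uniform_perm n) f"
  by (rule integrable_measure_pmf_finite) (simp only: set_uniform_perm finite_permutations_interval)

lemma max_runs_eq_normalized:
  assumes "n \<ge> 1"
  shows "real (max_runs n \<sigma>) = real n / 4 + sqrt (real n) * normalized_max_runs n \<sigma>"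
  unfolding normalized_max_runs_def normalizer_eq using assms by simp

lemma expectation_max_runs:
  assumes "n \<ge> 1"
  shows "measure_pmf.expectation (uniform_perm n) (\<lambda>\<sigma>. real (max_runs n \<sigma>))
    = real n / 4 + sqrt (real n) * measure_pmf.expectation (uniform_perm n) (normalized_max_runs n)"
  by (simp add: max_runs_eq_normalized[OF assms] integrable_uniform_perm)

lemma variance_max_runs:
  assumes "n \<ge> 1"
  shows "measure_pmf.variance (uniform_perm n) (\<lambda>\<sigma>. real (max_runs n \<sigma>))
    = real n * (measure_pmf.expectation (uniform_perm n) (\<lambda>\<sigma>. normalized_max_runs n \<sigma> ^ 2)
        - (measure_pmf.expectation (uniform_perm n) (normalized_max_runs n))\<^sup>2)"
proof -
  let ?e = "measure_pmf.expectation (uniform_perm n) (normalized_max_runs n)"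
  have "(real (max_runs n \<sigma>) - measure_pmf.expectation (uniform_perm n) (\<lambda>\<sigma>. real (max_runs n \<sigma>)))\<^sup>2
      = real n * (normalized_max_runs n \<sigma> - ?e)\<^sup>2" for \<sigma>
  proof -
    have "real (max_runs n \<sigma>) - measure_pmf.expectation (uniform_perm n) (\<lambda>\<sigma>. real (max_runs n \<sigma>))
        = sqrt (real n) * (normalized_max_runs n \<sigma> - ?e)"
      by (simp only: expectation_max_runs[OF assms] max_runs_eq_normalized[OF assms, of \<sigma>]) (simp add: algebra_simps)
    then show ?thesis by (simp add: power_mult_distrib)
  qed
  then have "measure_pmf.variance (uniform_perm n) (\<lambda>\<sigma>. real (max_runs n \<sigma>))
      = measure_pmf.expectation (uniform_perm n) (\<lambda>\<sigma>. real n * (normalized_max_runs n \<sigma> - ?e)\<^sup>2)"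
    by simp
  also have "\<dots> = real n * measure_pmf.variance (uniform_perm n) (normalized_max_runs n)"
    by (simp add: integrable_uniform_perm)
  also have "measure_pmf.variance (uniform_perm n) (normalized_max_runs n)
      = measure_pmf.expectation (uniform_perm n) (\<lambda>\<sigma>. normalized_max_runs n \<sigma> ^ 2) - ?e\<^sup>2"
    by (intro measure_pmf.variance_eq integrable_uniform_perm)
  finally show ?thesis .
qed

theorem theorem1p2:
  shows "weak_conv_m (\<lambda>n. distr (measure_pmf (uniform_perm n)) borel (normalized_max_runs n))
           (normal_law 0 (1/16))
       \<and> (\<forall>r::nat. (\<lambda>n. measure_pmf.expectation (uniform_perm n) (\<lambda>\<sigma>. normalized_max_runs n \<sigma> ^ r))
              \<longlonglongrightarrow> (LINT x | normal_law 0 (1/16). x ^ r))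
       \<and> (\<lambda>n. measure_pmf.expectation (uniform_perm n) (\<lambda>\<sigma>. real (max_runs n \<sigma>)) - real n / 4)
           \<in> o(\<lambda>n. real n powr (1/2))
       \<and> (\<lambda>n. measure_pmf.variance (uniform_perm n) (\<lambda>\<sigma>. real (max_runs n \<sigma>)) - real n / 16)
           \<in> o(\<lambda>n. real n)"
proof (intro conjI allI normalized_max_runs_weak_conv normalized_max_runs_moment_tendsto)
  let ?e = "\<lambda>n. measure_pmf.expectation (uniform_perm n) (normalized_max_runs n)"
  let ?e2 = "\<lambda>n. measure_pmf.expectation (uniform_perm n) (\<lambda>\<sigma>. normalized_max_runs n \<sigma> ^ 2)"
  \<comment> \<open>The moment limits for r = 1 and r = 2 are 0 and 1/16; undoing the normalisation
    multiplies the mean by sqrt n and the variance by n.\<close>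
  have "(LINT x|normal_law 0 (1 / 16). x ^ 1) = 0"
    unfolding normal_law_moment by (subst integral_std_normal_distribution_moment_odd) auto
  then have e: "?e \<longlonglongrightarrow> 0"
    using normalized_max_runs_moment_tendsto[of 1] by simp
  have "(LINT x|normal_law 0 (1 / 16). x ^ 2) = 1 / 16"
    unfolding normal_law_moment using std_normal_distribution_even_moments(1)[of 1] by simp
  then have e2: "?e2 \<longlonglongrightarrow> 1 / 16"
    using normalized_max_runs_moment_tendsto[of 2] by (simp only:)
  show "(\<lambda>n. measure_pmf.expectation (uniform_perm n) (\<lambda>\<sigma>. real (max_runs n \<sigma>)) - real n / 4)
      \<in> o(\<lambda>n. real n powr (1 / 2))"
  proof (rule smalloI_tendsto)
    show "(\<lambda>n. (measure_pmf.expectation (uniform_perm n) (\<lambda>\<sigma>. real (max_runs n \<sigma>)) - real n / 4)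
        / real n powr (1 / 2)) \<longlonglongrightarrow> 0"
      by (rule Lim_transform_eventually[OF e])
        (use eventually_ge_at_top[of 1] in \<open>eventually_elim, simp add: expectation_max_runs powr_half_sqrt\<close>)
    show "eventually (\<lambda>n. real n powr (1 / 2) \<noteq> 0) sequentially"
      using eventually_ge_at_top[of 1] by eventually_elim auto
  qed
  show "(\<lambda>n. measure_pmf.variance (uniform_perm n) (\<lambda>\<sigma>. real (max_runs n \<sigma>)) - real n / 16)
      \<in> o(\<lambda>n. real n)"
  proof (rule smalloI_tendsto)
    have lim: "(\<lambda>n. ?e2 n - (?e n)\<^sup>2 - 1 / 16) \<longlonglongrightarrow> 0"
      using tendsto_diff[OF tendsto_diff[OF e2 tendsto_power[OF e, of 2]] tendsto_const[of "1 / 16"]] by simp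
    show "(\<lambda>n. (measure_pmf.variance (uniform_perm n) (\<lambda>\<sigma>. real (max_runs n \<sigma>)) - real n / 16) / real n)
        \<longlonglongrightarrow> 0"
    proof (rule Lim_transform_eventually[OF lim])
      show "eventually (\<lambda>n. ?e2 n - (?e n)\<^sup>2 - 1 / 16
          = (measure_pmf.variance (uniform_perm n) (\<lambda>\<sigma>. real (max_runs n \<sigma>)) - real n / 16) / real n) sequentially"
        using eventually_ge_at_top[of 1]
      proof eventually_elim
        case (elim n)
        show ?case unfolding variance_max_runs[OF elim] using elim by (simp add: field_simps)
      qed
    qed
    show "eventually (\<lambda>n. real n \<noteq> 0) sequentially"
      using eventually_ge_at_top[of 1] by eventually_elim auto
  qed
qed

end
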